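(* Let $f$ be a bicritical rational map and $k\in\mathbb{N}$. Then $\mathrm{Deck}(f^k)$ is either cyclic or dihedral (where the Klein four-group $V_4$ counts as dihedral). Furthermore, if the degree of $f$ is odd, then $\mathrm{Deck}(f^k)$ is cyclic.
   Context: A rational map of degree $d\ge2$ is bicritical if it has exactly two critical points. For a rational map $F$, the deck group is $\mathrm{Deck}(F)=\{\tau \text{ Möbius transformation} : F\circ\tau = F\}$. $f^k$ denotes the $k$-th iterate of $f$. *)

theory Defs
  imports "HOL-Analysis.Analysis" "HOL-Computational_Algebra.Polynomial"
          "HOL-Algebra.Elementary_Groups" "HOL-Algebra.Multiplicative_Group"
begin

text \<open>The Riemann sphere is modelled as complex option, None being the point at infinity.\<close>

type_synonym sphere = "complex option"

definition rat_eval :: "complex poly \<Rightarrow> complex poly \<Rightarrow> sphere \<Rightarrow> sphere" where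
  "rat_eval p q z = (case z of
      Some w \<Rightarrow> (if poly q w = 0 then None else Some (poly p w / poly q w))
    | None \<Rightarrow> (if Polynomial.degree p > Polynomial.degree q then None
               else Some (Polynomial.coeff p (Polynomial.degree q) / Polynomial.lead_coeff q)))"

definition is_rational_map :: "(sphere \<Rightarrow> sphere) \<Rightarrow> nat \<Rightarrow> bool" where
  "is_rational_map F d \<longleftrightarrow>
     (\<exists>p q. q \<noteq> 0 \<and> coprime p q \<and> d = max (Polynomial.degree p) (Polynomial.degree q) \<and> F = rat_eval p q)"

fun sphere_nbhd :: "sphere \<Rightarrow> real \<Rightarrow> sphere set" where
  "sphere_nbhd (Some a) e = Some ` ball a e"
| "sphere_nbhd None e = insert None (Some ` {w. norm w > 1 / e})"

text \<open>Critical point: a point at which F fails to be locally injective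
  (equivalently, local degree at least 2).\<close>
definition critical_point :: "(sphere \<Rightarrow> sphere) \<Rightarrow> sphere \<Rightarrow> bool" where
  "critical_point F z \<longleftrightarrow> (\<forall>e>0. \<not> inj_on F (sphere_nbhd z e))"

definition bicritical :: "(sphere \<Rightarrow> sphere) \<Rightarrow> bool" where
  "bicritical F \<longleftrightarrow> (\<exists>d\<ge>2. is_rational_map F d) \<and> card {z. critical_point F z} = 2"

definition moebius :: "(sphere \<Rightarrow> sphere) \<Rightarrow> bool" where
  "moebius \<tau> \<longleftrightarrow> (\<exists>a b c d. a * d - b * c \<noteq> 0 \<and> \<tau> = rat_eval [:b, a:] [:d, c:])"

definition Deck :: "(sphere \<Rightarrow> sphere) \<Rightarrow> (sphere \<Rightarrow> sphere) set" where
  "Deck F = {\<tau>. moebius \<tau> \<and> F \<circ> \<tau> = F}"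

definition deck_group :: "(sphere \<Rightarrow> sphere) \<Rightarrow> (sphere \<Rightarrow> sphere) monoid" where
  "deck_group F = \<lparr>carrier = Deck F, mult = (\<lambda>\<sigma> \<tau>. \<sigma> \<circ> \<tau>), one = id\<rparr>"

text \<open>Finite dihedral group of order 2n, n \<ge> 2 (n = 2 gives the Klein four-group).\<close>
definition dihedral_group :: "('a, 'b) monoid_scheme \<Rightarrow> bool" where
  "dihedral_group G \<longleftrightarrow> group G \<and>
     (\<exists>n r s. n \<ge> 2 \<and> r \<in> carrier G \<and> s \<in> carrier G \<and>
        group.ord G r = n \<and> s \<noteq> \<one>\<^bsub>G\<^esub> \<and> s \<otimes>\<^bsub>G\<^esub> s = \<one>\<^bsub>G\<^esub> \<and>
        s \<otimes>\<^bsub>G\<^esub> r \<otimes>\<^bsub>G\<^esub> s = inv\<^bsub>G\<^esub> r \<and>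
        carrier G = {r [^]\<^bsub>G\<^esub> i \<otimes>\<^bsub>G\<^esub> s [^]\<^bsub>G\<^esub> j | i j :: nat. i < n \<and> j < 2} \<and>
        card (carrier G) = 2 * n)"

end

theory Submission
  imports Defs "HOL-Complex_Analysis.Conformal_Mappings"
    "HOL-Computational_Algebra.Fundamental_Theorem_Algebra"
    "HOL-Computational_Algebra.Field_as_Ring" "HOL-Computational_Algebra.Polynomial_Factorial"
begin

text \<open>A bicritical map of degree \<open>d\<close> is totally ramified at both critical points (degree count for the
  Wronskian), so \<open>f = A \<circ> z\<^sup>d \<circ> B\<close> with Moebius maps \<open>A\<close> and \<open>B\<close>. If \<open>\<tau>\<close> lies in \<open>Deck (f\<^sup>k\<^sup>+\<^sup>1)\<close>, then
  \<open>f\<^sup>k \<circ> \<tau>\<close> and \<open>f\<^sup>k\<close> have the same image under \<open>f\<close>, hence differ by a deck transformation of \<open>f\<close>. So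
  \<open>Deck (f\<^sup>k)\<close> is normal in \<open>Deck (f\<^sup>k\<^sup>+\<^sup>1)\<close>, and \<open>\<tau>\<^sup>d\<close> lies in it; thus \<open>d\<^sup>k\<close> is an exponent of
  \<open>Deck (f\<^sup>k)\<close>. By induction on \<open>k\<close> the group \<open>Deck (f\<^sup>k)\<close> preserves a pair of points: if it contains a
  rotation about the old pair of order at least 3, its normaliser preserves the same pair; otherwise
  \<open>d = 2\<close>, the group is elementary abelian, and \<open>Deck (f\<^sup>k\<^sup>+\<^sup>1)\<close> centralises one of its involutions, whose
  fixed points form the new pair. A group of Moebius maps of finite exponent that preserves \<open>{0, \<infinity>}\<close>
  consists of maps \<open>a z\<close> and \<open>a / z\<close>, so it is cyclic or dihedral; the maps \<open>a / z\<close> are involutions,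
  which odd exponent excludes.\<close>

hide_const (open) UnivPoly.coeff Module.smult Coset.order

section \<open>Homogeneous evaluation and Moebius maps\<close>

text \<open>Homogeneous coordinates \<open>[x : y]\<close> on the sphere. The pair
  \<open>(0, 0)\<close> gets the default value \<open>None\<close>, so arguments are usually
  required not to vanish together.\<close>

definition proj :: "complex \<Rightarrow> complex \<Rightarrow> sphere" where
  "proj x y = (if y = 0 then None else Some (x / y))"

lemma proj_eq_iff:
  assumes "x \<noteq> 0 \<or> y \<noteq> 0" "x' \<noteq> 0 \<or> y' \<noteq> 0"
  shows "proj x y = proj x' y' \<longleftrightarrow> x * y' = x' * y"
  using assms by (auto simp: proj_def field_simps)

lemma proj_scale: "c \<noteq> 0 \<Longrightarrow> proj (c * x) (c * y) = proj x y"
  by (auto simp: proj_def)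

lemma Some_eq_proj: "Some w = proj w 1"
  and None_eq_proj: "None = proj 1 0"
  by (auto simp: proj_def)

lemma proj_cases:
  obtains x y where "z = proj x y" "x \<noteq> 0 \<or> y \<noteq> 0"
proof (cases z)
  case None
  then show ?thesis using that[of 1 0] None_eq_proj by auto
next
  case (Some w)
  then show ?thesis using that[of w 1] Some_eq_proj[of w] by auto
qed

text \<open>Homogeneous evaluation of a pair of polynomials: unlike \<^const>\<open>rat_eval\<close> it treats numerator
  and denominator symmetrically, also when the denominator vanishes identically.\<close>

definition reval :: "complex poly \<Rightarrow> complex poly \<Rightarrow> sphere \<Rightarrow> sphere" where
  "reval p q z = (let n = max (degree p) (degree q) in
     case z of Some w \<Rightarrow> proj (poly p w) (poly q w) | None \<Rightarrow> proj (coeff p n) (coeff q n))"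

lemma reval_Some [simp]: "reval p q (Some w) = proj (poly p w) (poly q w)"
  by (simp add: reval_def)

lemma reval_None:
  "n = max (degree p) (degree q) \<Longrightarrow> reval p q None = proj (coeff p n) (coeff q n)"
  by (simp add: reval_def Let_def)

lemma rat_eval_eq_reval: "q \<noteq> 0 \<Longrightarrow> rat_eval p q = reval p q"
  by (rule ext)
    (auto simp: rat_eval_def reval_def proj_def Let_def max_def coeff_eq_0 split: option.split)

text \<open>A common divisor has no root, hence is a nonzero constant by the fundamental theorem of
  algebra.\<close>

lemma coprime_polyI:
  fixes p q :: "complex poly"
  assumes "\<And>w. poly p w \<noteq> 0 \<or> poly q w \<noteq> 0"
  shows "coprime p q"
proof (rule coprimeI)
  fix r assume r: "r dvd p" "r dvd q"
  have "\<nexists>w. poly r w = 0" using r assms by (auto elim!: dvdE)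
  then have "degree r = 0" "r \<noteq> 0"
    using fundamental_theorem_of_algebra[of r] by (auto simp: constant_degree)
  then show "is_unit r" by (simp add: is_unit_iff_degree)
qed

text \<open>The coefficients at \<open>n\<close> are the values at infinity of the pair homogenised
  in degree \<open>n\<close>, so this excludes a common zero at infinity.\<close>

lemma coprime_coeff_nonzero:
  fixes p q :: "complex poly"
  assumes "coprime p q" "n = max (degree p) (degree q)"
  shows "coeff p n \<noteq> 0 \<or> coeff q n \<noteq> 0"
proof (rule ccontr)
  assume *: "\<not> ?thesis"
  have "n = degree p \<or> n = degree q" using assms(2) by linarith
  \<comment> \<open>A vanishing leading coefficient means the zero polynomial, whose degree is 0 by
    convention; this forces \<open>n = 0\<close> and then \<open>p = q = 0\<close>.\<close>
  with * have "(p = 0 \<and> n = 0) \<or> (q = 0 \<and> n = 0)" by auto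
  then have "n = 0" and pq: "p = 0 \<or> q = 0" by auto
  then have "degree p = 0" "degree q = 0" using assms(2) by auto
  with * \<open>n = 0\<close> have "p = 0" "q = 0" using leading_coeff_0_iff by fastforce+
  with assms(1) show False by simp
qed

section \<open>Moebius maps as invertible matrices acting on homogeneous coordinates\<close>

definition mob :: "complex \<Rightarrow> complex \<Rightarrow> complex \<Rightarrow> complex \<Rightarrow> sphere \<Rightarrow> sphere" where
  "mob a b c d = rat_eval [:b, a:] [:d, c:]"

lemma moebius_iff: "moebius \<tau> \<longleftrightarrow> (\<exists>a b c d. a * d - b * c \<noteq> 0 \<and> \<tau> = mob a b c d)"
  by (simp add: moebius_def mob_def)

text \<open>Turns later identities between Moebius maps into linear algebra, without a separate case
  at infinity.\<close>

lemma mob_proj: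
  assumes "a * d - b * c \<noteq> 0" "x \<noteq> 0 \<or> y \<noteq> 0"
  shows "mob a b c d (proj x y) = proj (a * x + b * y) (c * x + d * y)"
proof -
  have q: "[:d, c:] \<noteq> 0" using assms(1) by auto
  have "mob a b c d = reval [:b, a:] [:d, c:]"
    unfolding mob_def by (rule rat_eval_eq_reval[OF q])
  moreover have "reval [:b, a:] [:d, c:] (proj x y) = proj (a * x + b * y) (c * x + d * y)"
  proof (cases "y = 0")
    case True
    have n: "max (degree [:b, a:]) (degree [:d, c:]) = 1" using assms(1) by auto
    show ?thesis
      using True assms(2) reval_None[OF n[symmetric]] proj_scale[of x a c]
      by (simp add: proj_def[of x] mult.commute)
  next
    case False
    have "proj (a * x + b * y) (c * x + d * y) = proj (y * (b + x / y * a)) (y * (d + x / y * c))"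
      using False by (simp add: distrib_left add.commute mult.commute)
    also have "\<dots> = proj (b + x / y * a) (d + x / y * c)"
      using False by (rule proj_scale)
    finally show ?thesis
      using False by (simp add: proj_def[of x])
  qed
  ultimately show ?thesis by simp
qed

text \<open>Cramer's rule: an invertible matrix kills no nonzero vector.\<close>

lemma mob_nonzero:
  fixes x y :: complex
  assumes "a * d - b * c \<noteq> 0" "x \<noteq> 0 \<or> y \<noteq> 0"
  shows "a * x + b * y \<noteq> 0 \<or> c * x + d * y \<noteq> 0"
proof (rule ccontr)
  assume "\<not> ?thesis"
  then have 1: "a * x + b * y = 0" "c * x + d * y = 0" by auto
  have "(a * d - b * c) * x = d * (a * x + b * y) - b * (c * x + d * y)"
       "(a * d - b * c) * y = a * (c * x + d * y) - c * (a * x + b * y)"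
    by (simp_all add: algebra_simps)
  with 1 assms show False by simp
qed

lemma mob_comp:
  assumes "a * d - b * c \<noteq> 0" "a' * d' - b' * c' \<noteq> 0"
  shows "mob a b c d \<circ> mob a' b' c' d' =
      mob (a * a' + b * c') (a * b' + b * d') (c * a' + d * c') (c * b' + d * d')"
    and "(a * a' + b * c') * (c * b' + d * d') - (a * b' + b * d') * (c * a' + d * c') \<noteq> 0"
proof -
  let ?a = "a * a' + b * c'" and ?b = "a * b' + b * d'"
    and ?c = "c * a' + d * c'" and ?d = "c * b' + d * d'"
  have "?a * ?d - ?b * ?c = (a * d - b * c) * (a' * d' - b' * c')"
    by (simp add: algebra_simps)
  then show det: "?a * ?d - ?b * ?c \<noteq> 0" using assms by simp
  show "mob a b c d \<circ> mob a' b' c' d' = mob ?a ?b ?c ?d"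
  proof
    fix z
    obtain x y where z: "z = proj x y" and nz: "x \<noteq> 0 \<or> y \<noteq> 0" by (rule proj_cases)
    show "(mob a b c d \<circ> mob a' b' c' d') z = mob ?a ?b ?c ?d z"
      using mob_proj[OF assms(2) nz] mob_proj[OF assms(1) mob_nonzero[OF assms(2) nz]]
        mob_proj[OF det nz] by (simp add: z algebra_simps)
  qed
qed

lemma mob_scalar:
  assumes "a \<noteq> 0"
  shows "mob a 0 0 a = id"
proof
  fix z
  obtain x y where z: "z = proj x y" and nz: "x \<noteq> 0 \<or> y \<noteq> 0" by (rule proj_cases)
  show "mob a 0 0 a z = id z"
    using mob_proj[of a a 0 0, OF _ nz] assms by (simp add: z proj_scale)
qed

lemma moebius_id [simp]: "moebius id"
  unfolding moebius_iff using mob_scalar[of 1] by (intro exI[of _ 1] exI[of _ 0]) auto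

lemma moebius_comp: "moebius \<sigma> \<Longrightarrow> moebius \<tau> \<Longrightarrow> moebius (\<sigma> \<circ> \<tau>)"
  unfolding moebius_iff using mob_comp by blast

lemma moebius_inverse:
  assumes "moebius \<tau>"
  obtains \<sigma> where "moebius \<sigma>" "\<sigma> \<circ> \<tau> = id" "\<tau> \<circ> \<sigma> = id"
proof -
  obtain a b c d where det: "a * d - b * c \<noteq> 0" and \<tau>: "\<tau> = mob a b c d"
    using assms by (auto simp: moebius_iff)
  \<comment> \<open>The inverse comes from the adjugate matrix: both products are the scalar matrix
    with entry \<open>a * d - b * c\<close>, which acts as the identity.\<close>
  have det': "d * a - (- b) * (- c) \<noteq> 0" using det by (simp add: mult.commute)
  have "mob d (-b) (-c) a \<circ> \<tau> = id" "\<tau> \<circ> mob d (-b) (-c) a = id"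
    unfolding \<tau> mob_comp(1)[OF det det'] mob_comp(1)[OF det' det]
    using mob_scalar[OF det] by (simp_all add: algebra_simps)
  moreover have "moebius (mob d (-b) (-c) a)" using det' unfolding moebius_iff by blast
  ultimately show ?thesis using that by blast
qed

lemma moebius_bij: "moebius \<tau> \<Longrightarrow> bij \<tau>"
  using moebius_inverse o_bij by metis

lemma moebius_inv:
  assumes "moebius \<tau>"
  shows "moebius (inv_into UNIV \<tau>)"
proof -
  obtain \<sigma> where "moebius \<sigma>" "\<sigma> \<circ> \<tau> = id" "\<tau> \<circ> \<sigma> = id"
    using moebius_inverse[OF assms] .
  then show ?thesis using inv_unique_comp by metis
qed

lemma moebius_inv_comp:
  assumes "moebius \<tau>"
  shows "inv_into UNIV \<tau> \<circ> \<tau> = id" "\<tau> \<circ> inv_into UNIV \<tau> = id"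
  using moebius_bij[OF assms] by (simp_all add: bij_is_inj bij_is_surj surj_iff[symmetric])

text \<open>This includes the constant maps, also the constant infinity (\<open>p = 1\<close>, \<open>q = 0\<close>).\<close>

definition ratl :: "(sphere \<Rightarrow> sphere) \<Rightarrow> bool" where
  "ratl F \<longleftrightarrow> (\<exists>p q. coprime p q \<and> F = reval p q)"

text \<open>The adjugate matrix recovers \<open>p\<close> and \<open>q\<close> from \<open>P\<close>
  and \<open>Q\<close> up to the determinant, so the two pairs have the same common divisors. The
  matrix also maps the nonzero vector of coefficients at the top index to a nonzero vector, so the
  maximal degree does not drop.\<close>

lemma reval_mob:
  fixes p q :: "complex poly" and a b c d :: complex
  defines "P \<equiv> smult a p + smult b q" and "Q \<equiv> smult c p + smult d q"
  assumes cop: "coprime p q" and det: "a * d - b * c \<noteq> 0"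
  shows "mob a b c d \<circ> reval p q = reval P Q" "coprime P Q"
    "max (degree P) (degree Q) = max (degree p) (degree q)"
proof -
  define n where "n = max (degree p) (degree q)"
  have p: "smult (a * d - b * c) p = smult d P - smult b Q"
    and q: "smult (a * d - b * c) q = smult a Q - smult c P"
    unfolding P_def Q_def by (rule poly_eqI, simp add: algebra_simps)+
  show "coprime P Q"
  proof (rule coprimeI)
    fix r assume "r dvd P" "r dvd Q"
    then have "r dvd smult (a * d - b * c) p" "r dvd smult (a * d - b * c) q"
      unfolding p q by (simp_all add: dvd_diff dvd_smult)
    then have "r dvd p" "r dvd q" using det by (simp_all add: dvd_smult_iff)
    then show "is_unit r" using cop coprime_common_divisor by blast
  qed
  have nz: "coeff p n \<noteq> 0 \<or> coeff q n \<noteq> 0"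
    using coprime_coeff_nonzero[OF cop n_def] .
  have "coeff P n \<noteq> 0 \<or> coeff Q n \<noteq> 0"
    using mob_nonzero[OF det nz] by (simp add: P_def Q_def)
  then have "n \<le> max (degree P) (degree Q)" using le_degree by (metis le_max_iff_disj)
  moreover have "degree P \<le> n" "degree Q \<le> n"
    unfolding P_def Q_def n_def by (intro degree_add_le; simp)+
  ultimately show eq: "max (degree P) (degree Q) = max (degree p) (degree q)"
    using n_def by linarith
  show "mob a b c d \<circ> reval p q = reval P Q"
  proof
    fix z
    show "(mob a b c d \<circ> reval p q) z = reval P Q z"
    proof (cases z)
      case None
      then show ?thesis
        using mob_proj[OF det nz] reval_None[OF n_def] reval_None[OF n_def[folded eq]]
        by (simp add: P_def Q_def)
    next
      case (Some w)
      then show ?thesis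
        using mob_proj[OF det coprime_poly_0[OF cop, of w]] by (simp add: P_def Q_def)
    qed
  qed
qed

lemma ratl_moebius_comp: "moebius \<tau> \<Longrightarrow> ratl F \<Longrightarrow> ratl (\<tau> \<circ> F)"
  unfolding ratl_def moebius_iff by (blast intro: reval_mob)

lemma ratl_id: "ratl id"
proof -
  have "id = reval [:0, 1:] 1"
  proof
    fix z show "id z = reval [:0, 1:] 1 z"
      by (cases z) (simp_all add: reval_def proj_def)
  qed
  then show ?thesis unfolding ratl_def by (metis coprime_1_right)
qed

lemma ratl_moebius: "moebius \<tau> \<Longrightarrow> ratl \<tau>"
  using ratl_moebius_comp[OF _ ratl_id] by simp

section \<open>Power maps\<close>

definition pw :: "nat \<Rightarrow> sphere \<Rightarrow> sphere" where
  "pw d = map_option (\<lambda>w. w ^ d)"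

lemma pw_proj: "d > 0 \<Longrightarrow> pw d (proj x y) = proj (x ^ d) (y ^ d)"
  by (simp add: pw_def proj_def power_divide)

text \<open>Here \<open>n\<close> only bounds the degree, because in \<open>reval\<close> one of the
  two polynomials may fall short of the maximum; both sides are then 0.\<close>

lemma coeff_power_mult:
  fixes p :: "complex poly"
  assumes "degree p \<le> n" "d > 0"
  shows "coeff (p ^ d) (d * n) = coeff p n ^ d"
proof (cases "degree p = n")
  case True
  then show ?thesis
    using lead_coeff_power[of p d] degree_power_eq[of p d] assms(2)
    by (cases "p = 0") (auto simp: zero_power mult.commute)
next
  case False
  then have "degree p < n" using assms(1) by simp
  moreover have "degree (p ^ d) \<le> degree p * d" by (rule degree_power_le)
  moreover have "degree p * d < d * n"
    using \<open>degree p < n\<close> assms(2) by (simp add: mult.commute)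
  ultimately have "degree (p ^ d) < d * n" by linarith
  then show ?thesis using \<open>degree p < n\<close> assms(2) by (simp add: coeff_eq_0)
qed

lemma reval_pw:
  assumes "coprime p q" "d > 0"
  shows "pw d \<circ> reval p q = reval (p ^ d) (q ^ d)"
proof
  fix z
  show "(pw d \<circ> reval p q) z = reval (p ^ d) (q ^ d) z"
  proof (cases z)
    case None
    define n where "n = max (degree p) (degree q)"
    have eq: "d * n = max (degree (p ^ d)) (degree (q ^ d))"
    proof -
      have "degree (r ^ d) = d * degree r" for r :: "complex poly"
        using degree_power_eq[of r d] assms(2) by (cases "r = 0") (auto simp: zero_power mult.commute)
      then show ?thesis unfolding n_def by (simp add: nat_mult_max_right)
    qed
    have "coeff (p ^ d) (d * n) = coeff p n ^ d" "coeff (q ^ d) (d * n) = coeff q n ^ d"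
      by (intro coeff_power_mult assms(2); simp add: n_def)+
    then show ?thesis
      unfolding None comp_apply reval_None[OF n_def] reval_None[OF eq] pw_proj[OF assms(2)] by simp
  next
    case (Some w)
    then show ?thesis by (simp add: pw_proj assms(2))
  qed
qed

lemma ratl_pw_comp: "d > 0 \<Longrightarrow> ratl F \<Longrightarrow> ratl (pw d \<circ> F)"
proof -
  assume "d > 0" "ratl F"
  then obtain p q where pq: "coprime p q" "F = reval p q" by (auto simp: ratl_def)
  have "coprime (p ^ d) (q ^ d)"
    using coprime_poly_0[OF pq(1)] \<open>d > 0\<close> by (intro coprime_polyI) simp
  with pq reval_pw[OF pq(1) \<open>d > 0\<close>] show "ratl (pw d \<circ> F)" unfolding ratl_def by blast
qed

section \<open>Identity theorem for rational maps\<close>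

lemma coeff_mult_le_degree:
  fixes p q :: "'a :: comm_semiring_0 poly"
  assumes "degree p \<le> m" "degree q \<le> n"
  shows "coeff (p * q) (m + n) = coeff p m * coeff q n"
proof (cases "degree p = m \<and> degree q = n")
  case True
  then show ?thesis using coeff_mult_degree_sum[of p q] by simp
next
  case False
  have "degree (p * q) < m + n" using degree_mult_le[of p q] False assms by linarith
  moreover have "degree p < m \<or> degree q < n" using False assms by linarith
  ultimately show ?thesis by (auto simp: coeff_eq_0)
qed

lemma reval_eq_of_cross:
  fixes p q r s :: "complex poly"
  assumes "coprime p q" "coprime r s" "p * s = r * q"
  shows "reval p q = reval r s"
proof
  fix z
  show "reval p q z = reval r s z"
  proof (cases z)
    case None
    define m where "m = max (degree p) (degree q)"
    define n where "n = max (degree r) (degree s)"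
    \<comment> \<open>Equality at infinity is read off from the coefficient at \<open>m + n\<close>
      of the cross-multiplied identity.\<close>
    have "coeff p m * coeff s n = coeff (p * s) (m + n)"
      by (rule coeff_mult_le_degree[symmetric]) (simp_all add: m_def n_def)
    also have "\<dots> = coeff (r * q) (n + m)" by (simp add: assms(3) add.commute)
    also have "\<dots> = coeff r n * coeff q m"
      by (rule coeff_mult_le_degree) (simp_all add: m_def n_def)
    finally show ?thesis
      using None reval_None[OF m_def] reval_None[OF n_def]
        proj_eq_iff[OF coprime_coeff_nonzero[OF assms(1) m_def] coprime_coeff_nonzero[OF assms(2) n_def]]
      by simp
  next
    case (Some w)
    have "poly (p * s) w = poly (r * q) w" using assms(3) by simp
    then show ?thesis
      using Some proj_eq_iff[OF coprime_poly_0[OF assms(1)] coprime_poly_0[OF assms(2)]]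
      by simp
  qed
qed

text \<open>Every point of agreement is a root of \<open>p * s - r * q\<close>, and a nonzero
  polynomial has only finitely many.\<close>

lemma cross_of_infinite:
  fixes p q r s :: "complex poly"
  assumes "coprime p q" "coprime r s" "infinite {w. reval p q (Some w) = reval r s (Some w)}"
  shows "p * s = r * q"
proof (rule ccontr)
  assume "p * s \<noteq> r * q"
  then have "finite {w. poly (p * s - r * q) w = 0}" by (intro poly_roots_finite) simp
  moreover have "{w. reval p q (Some w) = reval r s (Some w)} \<subseteq> {w. poly (p * s - r * q) w = 0}"
    using proj_eq_iff[OF coprime_poly_0[OF assms(1)] coprime_poly_0[OF assms(2)]]
    by auto
  ultimately show False using assms(3) finite_subset by blast
qed

lemma ratl_eqI:
  assumes "ratl F" "ratl G" "infinite {w. F (Some w) = G (Some w)}"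
  shows "F = G"
proof -
  obtain p q r s where "coprime p q" "F = reval p q" "coprime r s" "G = reval r s"
    using assms(1,2) by (auto simp: ratl_def)
  with assms(3) show ?thesis using cross_of_infinite reval_eq_of_cross by blast
qed

section \<open>The Moebius maps preserving the pair of 0 and infinity: \<open>rot c\<close> is
  multiplication by \<open>c\<close>, and \<open>flip c\<close> sends \<open>w\<close> to
  \<open>c / w\<close>\<close>

definition rot :: "complex \<Rightarrow> sphere \<Rightarrow> sphere" where "rot c = mob c 0 0 1"

definition flip :: "complex \<Rightarrow> sphere \<Rightarrow> sphere" where "flip c = mob 0 c 1 0"

lemma moebius_rot: "c \<noteq> 0 \<Longrightarrow> moebius (rot c)"
  unfolding moebius_iff rot_def by (intro exI[of _ c] exI[of _ 0] exI[of _ 1]) auto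

lemma rot_proj: "c \<noteq> 0 \<Longrightarrow> x \<noteq> 0 \<or> y \<noteq> 0 \<Longrightarrow> rot c (proj x y) = proj (c * x) y"
  unfolding rot_def using mob_proj[of c 1 0 0 x y] by simp

lemma flip_proj: "c \<noteq> 0 \<Longrightarrow> x \<noteq> 0 \<or> y \<noteq> 0 \<Longrightarrow> flip c (proj x y) = proj (c * y) x"
  unfolding flip_def using mob_proj[of 0 0 c 1 x y] by simp

lemma rot_flip_comp:
  assumes "a \<noteq> 0" "b \<noteq> 0"
  shows "rot a \<circ> rot b = rot (a * b)" "rot a \<circ> flip b = flip (a * b)"
    "flip a \<circ> rot b = flip (a / b)" "flip a \<circ> flip b = rot (a / b)"
proof -
  have "(rot a \<circ> rot b) z = rot (a * b) z \<and> (rot a \<circ> flip b) z = flip (a * b) z \<and>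
    (flip a \<circ> rot b) z = flip (a / b) z \<and> (flip a \<circ> flip b) z = rot (a / b) z" for z
  proof -
    obtain x y where z: "z = proj x y" and nz: "x \<noteq> 0 \<or> y \<noteq> 0" by (rule proj_cases)
    have "proj (a * x) (b * y) = proj (a / b * x) y" "proj (a * y) (b * x) = proj (a / b * y) x"
      using assms nz by (auto simp: proj_def)
    then show ?thesis using assms nz by (auto simp: z rot_proj flip_proj mult.assoc)
  qed
  then show "rot a \<circ> rot b = rot (a * b)" "rot a \<circ> flip b = flip (a * b)"
    "flip a \<circ> rot b = flip (a / b)" "flip a \<circ> flip b = rot (a / b)"
    by (auto simp: fun_eq_iff)
qed

lemma rot_1 [simp]: "rot 1 = id"
  unfolding rot_def by (rule mob_scalar) simp

lemma rot_Some: "c \<noteq> 0 \<Longrightarrow> rot c (Some w) = Some (c * w)"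
  using rot_proj[of c w 1] by (simp add: proj_def)

lemma rot_None: "c \<noteq> 0 \<Longrightarrow> rot c None = None"
  using rot_proj[of c 1 0] by (simp add: proj_def)

lemma flip_0: "c \<noteq> 0 \<Longrightarrow> flip c (Some 0) = None"
  using flip_proj[of c 0 1] by (simp add: proj_def)

lemma rot_eq_iff: "a \<noteq> 0 \<Longrightarrow> b \<noteq> 0 \<Longrightarrow> rot a = rot b \<longleftrightarrow> a = b"
  by (metis rot_Some mult_1_right option.inject)

lemma rot_neq_flip: "a \<noteq> 0 \<Longrightarrow> b \<noteq> 0 \<Longrightarrow> rot a \<noteq> flip b"
  using rot_Some[of a 0] flip_0[of b] by (metis option.distinct(1))

lemma rot_fixed: "c \<noteq> 0 \<Longrightarrow> c \<noteq> 1 \<Longrightarrow> rot c z = z \<longleftrightarrow> z = Some 0 \<or> z = None"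
  by (cases z) (auto simp: rot_Some rot_None)

text \<open>The hypotheses put a zero into each column of the matrix; invertibility leaves only
  diagonal and antidiagonal matrices.\<close>

lemma moebius_swap_or_fix:
  assumes "moebius g" "g (Some 0) \<in> {Some 0, None}" "g None \<in> {Some 0, None}"
  shows "\<exists>c. c \<noteq> 0 \<and> (g = rot c \<or> g = flip c)"
proof -
  obtain a b c d where det: "a * d - b * c \<noteq> 0" and g: "g = mob a b c d"
    using assms(1) by (auto simp: moebius_iff)
  have 0: "g (Some 0) = proj b d" and inf: "g None = proj a c"
    using mob_proj[OF det, of 0 1] mob_proj[OF det, of 1 0] Some_eq_proj[of 0] None_eq_proj
    by (simp_all add: g)
  have "b = 0 \<or> d = 0" "a = 0 \<or> c = 0"
    using 0 inf assms(2,3) by (auto simp: proj_def split: if_splits)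
  with det consider "b = 0" "c = 0" "a \<noteq> 0" "d \<noteq> 0" | "a = 0" "d = 0" "b \<noteq> 0" "c \<noteq> 0" by auto
  then show ?thesis
  proof cases
    case 1
    have "g z = rot (a / d) z" for z
    proof -
      obtain x y where z: "z = proj x y" and nz: "x \<noteq> 0 \<or> y \<noteq> 0" by (rule proj_cases)
      show ?thesis using mob_proj[OF det nz] 1 nz
        by (simp add: g z rot_proj) (simp add: proj_def)
    qed
    then have "g = rot (a / d)" by auto
    with 1 show ?thesis by (intro exI[of _ "a / d"]) auto
  next
    case 2
    have "g z = flip (b / c) z" for z
    proof -
      obtain x y where z: "z = proj x y" and nz: "x \<noteq> 0 \<or> y \<noteq> 0" by (rule proj_cases)
      show ?thesis using mob_proj[OF det nz] 2 nz
        by (simp add: g z flip_proj) (simp add: proj_def)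
    qed
    then have "g = flip (b / c)" by auto
    with 2 show ?thesis by (intro exI[of _ "b / c"]) auto
  qed
qed

section \<open>Critical points and the Wronskian\<close>

definition wron :: "complex poly \<Rightarrow> complex poly \<Rightarrow> complex poly" where
  "wron p q = pderiv p * q - p * pderiv q"

text \<open>The Wronskian is bilinear and alternating, so a change of basis in the pencil of
  \<open>p\<close> and \<open>q\<close> multiplies it by the determinant.\<close>

lemma wron_comb:
  "wron (smult a p + smult b q) (smult c p + smult d q) = smult (a * d - b * c) (wron p q)"
  by (rule poly_ext) (simp add: wron_def pderiv_add pderiv_smult algebra_simps)

text \<open>At \<open>w\<close> the term \<open>pderiv N * M\<close> vanishes to order exactly one
  less than \<open>N\<close>, whereas \<open>N * pderiv M\<close> vanishes at least to the order of
  \<open>N\<close>.\<close>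

lemma order_wron:
  assumes "N \<noteq> 0" "poly N w = 0" "poly M w \<noteq> 0"
  shows "Suc (order w (wron N M)) = order w N"
proof -
  define m where "m = order w N"
  have "m \<noteq> 0" using assms(1,2) order_root m_def by blast
  then obtain k where k: "m = Suc k" by (cases m) auto
  obtain r where N: "N = [:-w, 1:] ^ m * r" and r: "\<not> [:-w, 1:] dvd r"
    using order_decomp[OF assms(1), of w] unfolding m_def by blast
  \<comment> \<open>The cofactor of \<open>[:-w, 1:] ^ k\<close> in the Wronskian. Its value at
    \<open>w\<close> is \<open>m\<close> times the values of \<open>r\<close> and \<open>M\<close>
    there, hence nonzero in characteristic 0.\<close>
  define s where "s = smult (of_nat m) (r * M) + [:-w, 1:] * (pderiv r * M - r * pderiv M)"
  have dN: "pderiv N = smult (of_nat m) ([:-w, 1:] ^ k * r) + [:-w, 1:] ^ m * pderiv r"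
  proof -
    have "pderiv ([:-w, 1:] ^ Suc k) = smult (of_nat (Suc k)) ([:-w, 1:] ^ k)"
      by (subst pderiv_power_Suc) (simp add: pderiv_pCons)
    then show ?thesis unfolding N k pderiv_mult by (simp only: mult_smult_left mult_smult_right ac_simps)
  qed
  have "wron N M = [:-w, 1:] ^ k * s"
  proof (rule poly_ext)
    fix x
    have Nx: "poly N x = (x - w) * (x - w) ^ k * poly r x" unfolding N k by (simp add: algebra_simps)
    show "poly (wron N M) x = poly ([:-w, 1:] ^ k * s) x"
      unfolding wron_def s_def dN k by (simp add: Nx algebra_simps)
  qed
  moreover have "poly s w \<noteq> 0"
    using r assms(3) \<open>m \<noteq> 0\<close> unfolding s_def by (simp add: poly_eq_0_iff_dvd)
  then have "s \<noteq> 0" "order w s = 0" by (auto simp: order_root)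
  ultimately have "order w (wron N M) = k"
    using order_mult[of "[:-w, 1:] ^ k" s w] by (simp add: order_power_n_n)
  then show ?thesis using k m_def by simp
qed

text \<open>The order of the Wronskian at a point is the local degree minus one.\<close>

lemma order_wron_coprime:
  assumes cop: "coprime p q" and deg: "degree p \<le> d" "degree q \<le> d" and W: "wron p q \<noteq> 0"
  shows "order w (wron p q) < d"
    and "Suc (order w (wron p q)) = d \<Longrightarrow>
      \<exists>c. c \<noteq> 0 \<and> smult (poly q w) p + smult (- poly p w) q = smult c ([:-w, 1:] ^ d)"
proof -
  \<comment> \<open>The member of the pencil that vanishes at \<open>w\<close>. It is completed to a
    basis by whichever of \<open>q\<close> and \<open>p\<close> does not vanish at
    \<open>w\<close>.\<close>
  define N where "N = smult (poly q w) p + smult (- poly p w) q"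
  obtain M det where "poly M w \<noteq> 0" "wron N M = smult det (wron p q)" "det \<noteq> 0"
  proof (cases "poly q w = 0")
    case False
    show ?thesis
      using that[of q "poly q w"] wron_comb[of "poly q w" p "- poly p w" q 0 1] False
      by (simp add: N_def)
  next
    case True
    then have "poly p w \<noteq> 0" using coprime_poly_0[OF cop, of w] by simp
    then show ?thesis
      using that[of p "poly p w"] wron_comb[of "poly q w" p "- poly p w" q 1 0] True
      by (simp add: N_def)
  qed
  then have "N \<noteq> 0" and eq: "order w (wron p q) = order w (wron N M)"
    using W by (auto simp: wron_def order_smult)
  have "poly N w = 0" by (simp add: N_def)
  then have ord: "Suc (order w (wron p q)) = order w N"
    using order_wron[OF \<open>N \<noteq> 0\<close> _ \<open>poly M w \<noteq> 0\<close>] eq by simp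
  have "degree N \<le> d"
    unfolding N_def using deg by (intro degree_add_le) (auto intro: order_trans[OF degree_smult_le])
  then show "order w (wron p q) < d"
    using ord order_degree[OF \<open>N \<noteq> 0\<close>, of w] by linarith
  assume "Suc (order w (wron p q)) = d"
  \<comment> \<open>The power \<open>[:-w, 1:] ^ d\<close> exhausts the degree bound on
    \<open>N\<close>, so the cofactor is a constant.\<close>
  then obtain r where r: "N = [:-w, 1:] ^ d * r" using ord order_1[of w N] by (auto elim: dvdE)
  with \<open>N \<noteq> 0\<close> have "r \<noteq> 0" by auto
  then have "degree N = d + degree r" unfolding r by (simp add: degree_mult_eq degree_linear_power)
  with \<open>degree N \<le> d\<close> have "degree r = 0" by simp
  then obtain c where "r = [:c:]" by (rule degree_eq_zeroE)
  with r \<open>r \<noteq> 0\<close> show "\<exists>c. c \<noteq> 0 \<and> N = smult c ([:-w, 1:] ^ d)"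
    by (intro exI[of _ c]) auto
qed

text \<open>At index \<open>degree p + degree q - 1\<close> the two products contribute
  \<open>degree p\<close> and \<open>degree q\<close> times the same product of leading
  coefficients; they cannot cancel, since the degrees differ.\<close>

lemma degree_wron:
  assumes "degree p < degree q" "p \<noteq> 0"
  shows "wron p q \<noteq> 0" "Suc (degree (wron p q)) = degree p + degree q"
proof -
  define e n where "e = degree p" and "n = degree q - 1"
  have dq: "degree q = Suc n" using assms(1) n_def by simp
  have 1: "coeff (p * pderiv q) (e + n) = of_nat (Suc n) * (coeff p e * coeff q (Suc n))"
    by (subst coeff_mult_le_degree) (simp_all add: e_def degree_pderiv dq coeff_pderiv)
  have 2: "coeff (pderiv p * q) (e + n) = of_nat e * (coeff p e * coeff q (Suc n))"
  proof (cases e)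
    case 0
    then have "pderiv p = 0" using e_def by (simp add: pderiv_eq_0_iff)
    with 0 show ?thesis by simp
  next
    case (Suc e')
    have "coeff (pderiv p * q) (e' + Suc n) = coeff (pderiv p) e' * coeff q (Suc n)"
      using Suc by (intro coeff_mult_le_degree) (simp_all add: e_def degree_pderiv dq)
    with Suc show ?thesis by (simp add: coeff_pderiv)
  qed
  have "coeff (wron p q) (e + n) = (of_nat e - of_nat (Suc n)) * (coeff p e * coeff q (Suc n))"
    unfolding wron_def coeff_diff 1 2 by (simp only: left_diff_distrib)
  moreover have "of_nat e - of_nat (Suc n) \<noteq> (0 :: complex)"
    using assms(1) dq e_def by (metis eq_iff_diff_eq_0 nat_neq_iff of_nat_eq_iff)
  moreover have "coeff p e \<noteq> 0" using assms(2) e_def by simp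
  moreover have "coeff q (Suc n) \<noteq> 0" using dq by (metis degree_0 leading_coeff_0_iff nat.distinct(1))
  ultimately have nz: "coeff (wron p q) (e + n) \<noteq> 0" by simp
  then show "wron p q \<noteq> 0" by auto
  have "degree (pderiv p * q) \<le> e + n"
  proof (cases "e = 0")
    case True
    then have "pderiv p = 0" using e_def by (simp add: pderiv_eq_0_iff)
    then show ?thesis by simp
  next
    case False
    then show ?thesis
      using degree_mult_le[of "pderiv p" q] dq e_def by (simp add: degree_pderiv)
  qed
  moreover have "degree (p * pderiv q) \<le> e + n"
    using degree_mult_le[of p "pderiv q"] dq e_def by (simp add: degree_pderiv)
  ultimately have "degree (wron p q) \<le> e + n" unfolding wron_def by (rule degree_diff_le)
  with le_degree[OF nz] show "Suc (degree (wron p q)) = degree p + degree q"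
    using dq e_def by simp
qed

text \<open>The fundamental theorem of algebra with multiplicities; points of \<open>A\<close> that
  are not roots have order 0.\<close>

lemma degree_eq_sum_order:
  fixes p :: "complex poly"
  assumes "p \<noteq> 0" "finite A" "{z. poly p z = 0} \<subseteq> A"
  shows "degree p = (\<Sum>z\<in>A. order z p)"
proof -
  have "degree p = (\<Sum>z\<in>{z. poly p z = 0}. order z p)"
    using size_proots_complex[of p] assms(1)
    by (simp add: size_multiset_overloaded_eq set_count_proots count_proots)
  also have "\<dots> = (\<Sum>z\<in>A. order z p)"
    using assms by (intro sum.mono_neutral_left) (auto simp: order_root)
  finally show ?thesis .
qed

text \<open>The derivative of an injective holomorphic function on an open set vanishes
  nowhere.\<close>

lemma deriv_zero_not_inj:
  fixes g :: "complex \<Rightarrow> complex"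
  assumes "(g has_field_derivative 0) (at w)" "g holomorphic_on ball w r" "r > 0"
  shows "\<not> inj_on g (ball w r)"
  using holomorphic_injective_imp_regular[OF assms(2), of w] DERIV_imp_deriv[OF assms(1)] assms(3)
  by auto

lemma poly_nonzero_ball:
  fixes q :: "complex poly"
  assumes "poly q w \<noteq> 0" "e > 0"
  obtains r where "0 < r" "r \<le> e" "\<And>z. z \<in> ball w r \<Longrightarrow> poly q z \<noteq> 0"
proof -
  have "open {z. poly q z \<noteq> 0}" by (intro open_Collect_neq continuous_intros)
  then obtain r where "r > 0" "ball w r \<subseteq> {z. poly q z \<noteq> 0}"
    using assms(1) by (auto elim: openE)
  then show ?thesis using that[of "min r e"] assms(2) by (auto simp: subset_iff)
qed

lemma critical_point_moebius_comp:
  "moebius \<tau> \<Longrightarrow> critical_point (\<tau> \<circ> F) z \<longleftrightarrow> critical_point F z"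
  unfolding critical_point_def
  by (metis moebius_bij bij_is_inj comp_inj_on inj_on_imageI2 inj_on_subset subset_UNIV)

text \<open>The derivative of \<open>p / q\<close> is the Wronskian divided by the square of
  \<open>q\<close>. At a pole, post-composition with the reciprocal map swaps \<open>p\<close> and
  \<open>q\<close>.\<close>

lemma critical_point_Some:
  assumes cop: "coprime p q" and W: "poly (wron p q) w = 0"
  shows "critical_point (reval p q) (Some w)"
proof -
  have *: "critical_point (reval p q) (Some w)"
    if W: "poly (wron p q) w = 0" and q: "poly q w \<noteq> 0" for p q
  proof (unfold critical_point_def, intro allI impI notI)
    fix e :: real assume e: "e > 0" and inj: "inj_on (reval p q) (sphere_nbhd (Some w) e)"
    obtain r where r: "0 < r" "r \<le> e" "\<And>z. z \<in> ball w r \<Longrightarrow> poly q z \<noteq> 0"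
      using poly_nonzero_ball[OF q e] by blast
    define g where "g = (\<lambda>z. poly p z / poly q z)"
    have "inj_on g (ball w r)"
    proof (rule inj_onI)
      fix x y assume xy: "x \<in> ball w r" "y \<in> ball w r" "g x = g y"
      then have "reval p q (Some x) = reval p q (Some y)" using r(3) by (simp add: g_def proj_def)
      moreover have "Some x \<in> sphere_nbhd (Some w) e" "Some y \<in> sphere_nbhd (Some w) e"
        using xy r(2) by auto
      ultimately show "x = y" using inj_onD[OF inj] by blast
    qed
    moreover have "(g has_field_derivative 0) (at w)"
    proof -
      have "(g has_field_derivative (poly (pderiv p) w * poly q w - poly p w * poly (pderiv q) w)
              / (poly q w * poly q w)) (at w)"
        unfolding g_def using q by (intro DERIV_divide poly_DERIV)
      then show ?thesis using W by (simp add: wron_def)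
    qed
    moreover have "g holomorphic_on ball w r"
      unfolding g_def using r(3) by (intro holomorphic_intros) auto
    ultimately show False using deriv_zero_not_inj r(1) by blast
  qed
  show ?thesis
  proof (cases "poly q w = 0")
    case False
    then show ?thesis using *[OF W] by blast
  next
    case True
    then have p: "poly p w \<noteq> 0" using coprime_poly_0[OF cop, of w] by simp
    have "poly (wron q p) w = 0" using W by (simp add: wron_def algebra_simps)
    then have "critical_point (reval q p) (Some w)" using *[OF _ p] by blast
    moreover have "mob 0 1 1 0 \<circ> reval p q = reval q p"
      using reval_mob(1)[OF cop, of 0 0 1 1] by simp
    moreover have "moebius (mob 0 1 1 0)"
      unfolding moebius_iff by (rule exI[of _ 0], rule exI[of _ 1], rule exI[of _ 1], rule exI[of _ 0]) simp
    ultimately show ?thesis using critical_point_moebius_comp by metis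
  qed
qed

text \<open>In the chart \<iota> at infinity the map becomes \<open>z ^ (2 + k)\<close> times a
  quotient of reflected polynomials, regular at 0, so its derivative vanishes there.\<close>

lemma critical_point_None:
  assumes deg: "degree p + 2 \<le> degree q"
  shows "critical_point (reval p q) None"
proof (unfold critical_point_def, intro allI impI notI)
  fix e :: real assume e: "e > 0" and inj: "inj_on (reval p q) (sphere_nbhd None e)"
  obtain k where k: "degree q = degree p + 2 + k" using deg le_Suc_ex by blast
  define P Q where "P = reflect_poly p" and "Q = reflect_poly q"
  define h where "h = (\<lambda>z. z ^ 2 * (z ^ k * poly P z / poly Q z))"
  define \<iota> :: "complex \<Rightarrow> sphere" where "\<iota> = (\<lambda>z. if z = 0 then None else Some (inverse z))"
  have "q \<noteq> 0" using deg by auto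
  then have Q0: "poly Q 0 \<noteq> 0" by (simp add: Q_def)
  obtain r where r: "0 < r" "r \<le> e" "\<And>z. z \<in> ball 0 r \<Longrightarrow> poly Q z \<noteq> 0"
    using poly_nonzero_ball[OF Q0 e] by blast
  have h: "reval p q (\<iota> z) = Some (h z)" if z: "z \<in> ball 0 r" for z
  proof (cases "z = 0")
    case True
    have "degree q = max (degree p) (degree q)" using deg by simp
    from reval_None[OF this] show ?thesis
      using True \<open>q \<noteq> 0\<close> deg by (simp add: \<iota>_def h_def proj_def coeff_eq_0)
  next
    case False
    then have PQ: "poly P z = z ^ degree p * poly p (inverse z)"
        "poly Q z = z ^ degree q * poly q (inverse z)"
      by (simp_all add: P_def Q_def poly_reflect_poly_nz)
    with r(3)[OF z] False have "poly q (inverse z) \<noteq> 0" by auto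
    then show ?thesis using False
      by (simp add: \<iota>_def h_def proj_def PQ k power_add power2_eq_square field_simps)
  qed
  have "inj_on h (ball 0 r)"
  proof (rule inj_onI)
    fix x y assume xy: "x \<in> ball 0 r" "y \<in> ball 0 r" "h x = h y"
    have "\<iota> z \<in> sphere_nbhd None e" if "z \<in> ball 0 r" for z
      using that r(2) e by (auto simp: \<iota>_def norm_inverse inverse_eq_divide norm_divide divide_strict_left_mono)
    then have "\<iota> x = \<iota> y" using inj_onD[OF inj] h xy by metis
    then show "x = y" by (auto simp: \<iota>_def split: if_splits)
  qed
  moreover have "h holomorphic_on ball 0 r"
    unfolding h_def using r(3) by (intro holomorphic_intros) auto
  moreover have "(h has_field_derivative 0) (at 0)"
  proof -
    define g where "g = (\<lambda>z. z ^ k * poly P z / poly Q z)"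
    have "g holomorphic_on ball 0 r"
      unfolding g_def using r(3) by (intro holomorphic_intros) auto
    then obtain D where "(g has_field_derivative D) (at 0)"
      using r(1) holomorphic_on_open[of "ball 0 r" g] by (metis centre_in_ball open_ball)
    then have "((\<lambda>z. z ^ 2 * g z) has_field_derivative 0) (at 0)"
      by (auto intro!: derivative_eq_intros)
    then show ?thesis by (simp add: h_def g_def)
  qed
  ultimately show False using deriv_zero_not_inj r(1) by blast
qed

section \<open>Normal form of bicritical maps\<close>

lemma reval_linear:
  assumes "a * d - b * c \<noteq> 0"
  shows "reval [:b, a:] [:d, c:] = mob a b c d" "coprime [:b, a:] [:d, c:]"
proof -
  have "[:d, c:] \<noteq> 0" using assms by auto
  from rat_eval_eq_reval[OF this] show "reval [:b, a:] [:d, c:] = mob a b c d"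
    by (simp add: mob_def)
  show "coprime [:b, a:] [:d, c:]"
    using mob_nonzero[OF assms, of _ 1] by (intro coprime_polyI) (simp add: algebra_simps)
qed

text \<open>Coprimality turns \<open>p * s = r * q\<close> into divisibilities in both
  directions.\<close>

lemma reval_degree_unique:
  assumes "coprime p q" "q \<noteq> 0" "coprime r s" "s \<noteq> 0" "reval p q = reval r s"
  shows "max (degree p) (degree q) = max (degree r) (degree s)"
proof -
  have *: "max (degree p) (degree q) \<le> max (degree r) (degree s)"
    if "coprime p q" "q \<noteq> 0" "s \<noteq> 0" "p * s = r * q" for p q r s :: "complex poly"
  proof -
    have "p dvd r * q" "q dvd p * s" using that(4) by (metis dvd_triv_left dvd_triv_right)+
    then have "p dvd r" "q dvd s"
      using that(1) by (auto simp: coprime_dvd_mult_left_iff coprime_dvd_mult_right_iff coprime_commute)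
    \<comment> \<open>Divisibility bounds the degree only below a nonzero polynomial, so
      \<open>r = 0\<close> needs its own argument.\<close>
    moreover have "p = 0" if "r = 0" using \<open>p * s = r * q\<close> that \<open>s \<noteq> 0\<close> by auto
    ultimately have "degree p \<le> degree r" "degree q \<le> degree s"
      using \<open>s \<noteq> 0\<close> by (auto intro: dvd_imp_degree_le)
    then show ?thesis by linarith
  qed
  have "p * s = r * q"
    using assms(5) by (intro cross_of_infinite assms(1,3)) (simp add: infinite_UNIV_char_0)
  then show ?thesis
    using *[of p q s r] *[of r s q p] assms(1-4) by fastforce
qed

text \<open>Identifies the degree given in the theorem with the degree at least 2 hidden in
  \<open>bicritical\<close>.\<close>

lemma rational_map_degree_unique:
  assumes "is_rational_map F d" "is_rational_map F d'"
  shows "d = d'"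
  using assms reval_degree_unique unfolding is_rational_map_def by (metis rat_eval_eq_reval)

text \<open>If the determinant were 0, then \<open>smult c N = smult a M\<close> and
  \<open>smult d N = smult b M\<close>; evaluation at \<open>u\<close> would give
  \<open>a = b = 0\<close>, hence \<open>N = 0\<close>.\<close>

lemma pencil_independent:
  fixes p q :: "complex poly"
  assumes "N = smult a p + smult b q" "M = smult c p + smult d q"
    and "N \<noteq> 0" "poly N u = 0" "poly M u \<noteq> 0"
  shows "a * d - b * c \<noteq> 0"
proof
  assume det: "a * d - b * c = 0"
  have "smult c N - smult a M = smult (- (a * d - b * c)) q"
    "smult d N - smult b M = smult (a * d - b * c) p"
    unfolding assms(1,2) by (rule poly_eqI, simp add: algebra_simps)+
  then have "smult c N = smult a M" "smult d N = smult b M" using det by simp_all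
  then have "c * poly N u = a * poly M u" "d * poly N u = b * poly M u"
    by (metis poly_smult)+
  then have "a = 0" "b = 0" using assms(4,5) by auto
  then show False using assms(1,3) by simp
qed

lemma totally_ramified_pencil:
  assumes "coprime p q" "degree p < degree q" "wron p q \<noteq> 0"
    and "Suc (order u (wron p q)) = degree q"
  obtains a b where "smult a p + smult b q = [:-u, 1:] ^ degree q"
proof -
  obtain k where k: "k \<noteq> 0"
    "smult (poly q u) p + smult (- poly p u) q = smult k ([:-u, 1:] ^ degree q)"
    using order_wron_coprime(2)[of p q "degree q" u] assms by auto
  have "smult (poly q u / k) p + smult (- poly p u / k) q =
    smult (1 / k) (smult (poly q u) p + smult (- poly p u) q)"
    by (rule poly_eqI) (simp add: diff_divide_distrib)
  also have "\<dots> = [:-u, 1:] ^ degree q" unfolding k(2) using k(1) by simp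
  finally show ?thesis by (rule that)
qed

text \<open>All roots of the Wronskian are critical, and its order at each point is at most
  \<open>degree q - 1\<close>. With only two critical points its degree forces maximal order at the
  finite ones, where a member of the pencil is then a full power of a linear form.\<close>

lemma bicritical_pencil:
  assumes cop: "coprime p q" and deg: "degree p < degree q"
    and card: "card {z. critical_point (reval p q) z} = 2"
  obtains \<alpha> \<beta> \<gamma> \<delta> a b c d where "\<alpha> * \<delta> - \<beta> * \<gamma> \<noteq> 0" "a * d - b * c \<noteq> 0"
    and "smult \<alpha> p + smult \<beta> q = [:b, a:] ^ degree q"
    and "smult \<gamma> p + smult \<delta> q = [:d, c:] ^ degree q"
proof -
  define n where "n = degree q"
  define W where "W = wron p q"
  have "p \<noteq> 0"
  proof
    assume "p = 0"
    then have "is_unit q" "q \<noteq> 0" using cop deg by auto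
    then show False using deg by (simp add: is_unit_iff_degree)
  qed
  then have W: "W \<noteq> 0" and degW: "Suc (degree W) = degree p + n"
    using degree_wron[OF deg] by (simp_all add: W_def n_def)
  have ord: "order u W < n" for u
    using order_wron_coprime(1)[OF cop, of n u] deg W by (simp add: W_def n_def)
  have crit: "critical_point (reval p q) (Some u)" if "poly W u = 0" for u
    using critical_point_Some[OF cop] that by (simp add: W_def)
  obtain z1 z2 where S: "{z. critical_point (reval p q) z} = {z1, z2}" "z1 \<noteq> z2"
    using card by (auto simp: card_2_iff)
  consider (inf) u where "{z. critical_point (reval p q) z} = {None, Some u}"
    | (fin) u v where "{z. critical_point (reval p q) z} = {Some u, Some v}" "u \<noteq> v"
    using S by (cases z1; cases z2) (auto simp: insert_commute)
  then show ?thesis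
  proof cases
    case inf
    then have "{z. poly W z = 0} \<subseteq> {u}" using crit by blast
    then have "degree W = order u W" using degree_eq_sum_order[OF W, of "{u}"] by simp
    \<comment> \<open>The degree \<open>degree p + n - 1\<close> of \<open>W\<close> is concentrated
      at \<open>u\<close>, where at most \<open>n - 1\<close> is possible.\<close>
    with degW ord[of u] have *: "degree p = 0" "Suc (order u W) = n" by linarith+
    obtain \<alpha> \<beta> where 1: "smult \<alpha> p + smult \<beta> q = [:-u, 1:] ^ degree q"
      using totally_ramified_pencil[OF cop deg, of u] W * by (auto simp: W_def n_def)
    obtain k where k: "p = [:k:]" "k \<noteq> 0"
      using *(1) \<open>p \<noteq> 0\<close> by (metis degree_eq_zeroE pCons_0_0)
    \<comment> \<open>The linear form belonging to the critical point at infinity is the constant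
      1.\<close>
    have 2: "smult (1 / k) p + smult 0 q = [:1, 0:] ^ degree q"
      using k by (simp flip: one_pCons)
    have "\<alpha> * 0 - \<beta> * (1 / k) \<noteq> 0"
      by (rule pencil_independent[OF 1[symmetric] 2[symmetric], of u])
        (use deg in \<open>simp_all add: poly_power\<close>)
    then show ?thesis using that[OF _ _ 1 2] by simp
  next
    case fin
    then have "\<not> critical_point (reval p q) None" by blast
    then have "degree p + 1 = n"
      using critical_point_None[of p q] deg n_def by linarith
    moreover have "{z. poly W z = 0} \<subseteq> {u, v}" using fin crit by blast
    then have "degree W = order u W + order v W"
      using degree_eq_sum_order[OF W, of "{u, v}"] fin(2) by simp
    \<comment> \<open>The degree of \<open>W\<close> is \<open>2 * n - 2\<close>, shared by two
      orders of at most \<open>n - 1\<close> each.\<close>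
    ultimately have *: "Suc (order u W) = n" "Suc (order v W) = n"
      using degW ord[of u] ord[of v] by linarith+
    obtain \<alpha> \<beta> where 1: "smult \<alpha> p + smult \<beta> q = [:-u, 1:] ^ degree q"
      using totally_ramified_pencil[OF cop deg, of u] W * by (auto simp: W_def n_def)
    obtain \<gamma> \<delta> where 2: "smult \<gamma> p + smult \<delta> q = [:-v, 1:] ^ degree q"
      using totally_ramified_pencil[OF cop deg, of v] W * by (auto simp: W_def n_def)
    have "\<alpha> * \<delta> - \<beta> * \<gamma> \<noteq> 0"
      by (rule pencil_independent[OF 1[symmetric] 2[symmetric], of u])
        (use deg fin(2) in \<open>simp_all add: poly_power\<close>)
    then show ?thesis using that[OF _ _ 1 2] fin(2) by simp
  qed
qed

text \<open>Post-composition moves the value at infinity to 0: the first row of the matrix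
  annihilates the coefficients at \<open>n\<close>, and the second only makes it invertible.\<close>

lemma reduce_degree:
  assumes cop: "coprime p q" and n: "n = max (degree p) (degree q)" "n > 0"
  obtains \<tau> r s where "moebius \<tau>" "coprime r s" "\<tau> \<circ> reval p q = reval r s"
    "degree r < degree s" "degree s = n"
proof -
  define N where "N = smult (coeff q n) p + smult (- coeff p n) q"
  obtain c d where det: "coeff q n * d - (- coeff p n) * c \<noteq> 0"
  proof (cases "coeff q n = 0")
    case True
    then show ?thesis using that[of 0 1] coprime_coeff_nonzero[OF cop n(1)] by simp
  next
    case False
    then show ?thesis using that[of 1 0] by simp
  qed
  define M where "M = smult c p + smult d q"
  note rm = reval_mob[OF cop det, folded N_def M_def]
  have "coeff N n = 0" by (simp add: N_def)
  moreover have "degree N \<le> n" using rm(3) n(1) by simp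
  ultimately have "degree N < n"
    using n(2) by (metis degree_0 leading_coeff_0_iff nat_less_le)
  moreover have "degree M = n" using rm(3) n(1) \<open>degree N < n\<close> by linarith
  moreover have "moebius (mob (coeff q n) (- coeff p n) c d)"
    using det unfolding moebius_iff by blast
  ultimately show ?thesis using that rm(1,2) by metis
qed

text \<open>Two independent members of the pencil are \<open>d\<close>-th powers of linear forms.
  Taking them as new numerator and denominator turns the map into \<open>pw d\<close> after a
  Moebius map.\<close>

lemma bicritical_normal_form:
  assumes "bicritical f" "is_rational_map f d"
  obtains A B where "d \<ge> 2" "moebius A" "moebius B" "f = A \<circ> pw d \<circ> B"
proof -
  obtain d' where "is_rational_map f d'" "d' \<ge> 2" and card: "card {z. critical_point f z} = 2"
    using assms(1) by (auto simp: bicritical_def)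
  then have d: "d \<ge> 2" using rational_map_degree_unique[OF assms(2)] by blast
  obtain p q where pq: "coprime p q" "d = max (degree p) (degree q)" "f = reval p q"
    using assms(2) rat_eval_eq_reval unfolding is_rational_map_def by blast
  obtain \<tau> r s where \<tau>: "moebius \<tau>" and rs: "coprime r s" "\<tau> \<circ> f = reval r s"
    "degree r < degree s" "degree s = d"
    using reduce_degree[OF pq(1,2)] d pq(3) by auto
  have "card {z. critical_point (reval r s) z} = 2"
    using card unfolding rs(2)[symmetric] critical_point_moebius_comp[OF \<tau>] .
  then obtain \<alpha> \<beta> \<gamma> \<delta> a b c e where det: "\<alpha> * \<delta> - \<beta> * \<gamma> \<noteq> 0" "a * e - b * c \<noteq> 0"
    and pen: "smult \<alpha> r + smult \<beta> s = [:b, a:] ^ d" "smult \<gamma> r + smult \<delta> s = [:e, c:] ^ d"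
    using bicritical_pencil[OF rs(1,3)] rs(4) by metis
  have "mob \<alpha> \<beta> \<gamma> \<delta> \<circ> (\<tau> \<circ> f) = pw d \<circ> mob a b c e"
    using reval_mob(1)[OF rs(1) det(1)] reval_pw[OF reval_linear(2)[OF det(2)], of d] d
    by (simp add: rs(2) pen reval_linear(1)[OF det(2)])
  moreover have "moebius (mob \<alpha> \<beta> \<gamma> \<delta> \<circ> \<tau>)"
    by (rule moebius_comp[OF _ \<tau>]) (use det(1) moebius_iff in blast)
  then obtain \<sigma> where "moebius \<sigma>" "\<sigma> \<circ> (mob \<alpha> \<beta> \<gamma> \<delta> \<circ> \<tau>) = id"
    using moebius_inverse by metis
  ultimately have "f = \<sigma> \<circ> pw d \<circ> mob a b c e" by (metis comp_assoc id_comp)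
  moreover have "moebius (mob a b c e)" using det(2) moebius_iff by blast
  ultimately show ?thesis using that d \<open>moebius \<sigma>\<close> by blast
qed

section \<open>Deck groups of iterates preserve a pair of points\<close>

lemma moebius_inv_apply [simp]:
  assumes "moebius \<tau>"
  shows "inv_into UNIV \<tau> (\<tau> z) = z" "\<tau> (inv_into UNIV \<tau> z) = z"
  using moebius_inv_comp[OF assms] by (auto simp: fun_eq_iff)

lemma Deck_id: "id \<in> Deck F"
  by (simp add: Deck_def)

lemma Deck_comp: "g \<in> Deck F \<Longrightarrow> h \<in> Deck F \<Longrightarrow> g \<circ> h \<in> Deck F"
  by (auto simp: Deck_def moebius_comp fun_eq_iff)

lemma Deck_inv: "g \<in> Deck F \<Longrightarrow> inv_into UNIV g \<in> Deck F"
  by (auto simp: Deck_def moebius_inv fun_eq_iff) (metis moebius_inv_apply(2))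

lemma DeckD: "g \<in> Deck F \<Longrightarrow> moebius g" "g \<in> Deck F \<Longrightarrow> F (g z) = F z"
  by (auto simp: Deck_def fun_eq_iff)

section \<open>Conjugation and maps preserving an axis\<close>

definition conjm :: "(sphere \<Rightarrow> sphere) \<Rightarrow> (sphere \<Rightarrow> sphere) \<Rightarrow> sphere \<Rightarrow> sphere" where
  "conjm \<phi> x = inv_into UNIV \<phi> \<circ> x \<circ> \<phi>"

lemma conjm_comp: "moebius \<phi> \<Longrightarrow> conjm \<phi> x \<circ> conjm \<phi> y = conjm \<phi> (x \<circ> y)"
  by (simp add: conjm_def fun_eq_iff)

lemma conjm_id: "moebius \<phi> \<Longrightarrow> conjm \<phi> id = id"
  by (simp add: conjm_def fun_eq_iff)

lemma conjm_eq_iff: "moebius \<phi> \<Longrightarrow> conjm \<phi> x = conjm \<phi> y \<longleftrightarrow> x = y"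
  unfolding conjm_def fun_eq_iff comp_apply by (metis moebius_inv_apply)

lemma conjm_eq_id_iff: "moebius \<phi> \<Longrightarrow> conjm \<phi> x = id \<longleftrightarrow> x = id"
  using conjm_eq_iff[of \<phi> x id] conjm_id by simp

lemma conjm_conjm:
  assumes "moebius \<phi>" "moebius \<psi>"
  shows "conjm \<phi> (conjm \<psi> x) = conjm (\<psi> \<circ> \<phi>) x"
  unfolding conjm_def o_inv_distrib[OF moebius_bij[OF assms(2)] moebius_bij[OF assms(1)]]
  by (simp add: comp_assoc)

lemma moebius_conjm: "moebius \<phi> \<Longrightarrow> moebius x \<Longrightarrow> moebius (conjm \<phi> x)"
  unfolding conjm_def by (intro moebius_comp moebius_inv)

lemma conjm_inv_cancel: "moebius \<phi> \<Longrightarrow> conjm \<phi> (\<phi> \<circ> g \<circ> inv_into UNIV \<phi>) = g"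
  by (simp add: conjm_def fun_eq_iff)

text \<open>For a Moebius map \<phi> these are exactly the Moebius maps that preserve the pair of
  points sent by \<phi> to 0 and infinity.\<close>

definition axial_map :: "(sphere \<Rightarrow> sphere) \<Rightarrow> (sphere \<Rightarrow> sphere) \<Rightarrow> bool" where
  "axial_map \<phi> g \<longleftrightarrow> (\<exists>c. c \<noteq> 0 \<and> (g = conjm \<phi> (rot c) \<or> g = conjm \<phi> (flip c)))"

text \<open>Such a map permutes the two common fixed points of the rotations about the axis.\<close>

lemma axial_of_conjugation:
  assumes "moebius \<phi>" "moebius g" "a \<noteq> 0" "a \<noteq> 1" "b \<noteq> 0" "b \<noteq> 1"
    and comm: "g \<circ> conjm \<phi> (rot a) = conjm \<phi> (rot b) \<circ> g"
  shows "axial_map \<phi> g"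
proof -
  define k where "k = \<phi> \<circ> g \<circ> inv_into UNIV \<phi>"
  have k: "moebius k" unfolding k_def by (intro moebius_comp moebius_inv assms(1,2))
  have g: "g = conjm \<phi> k" unfolding k_def by (rule conjm_inv_cancel[OF assms(1), symmetric])
  have "conjm \<phi> (k \<circ> rot a) = conjm \<phi> (rot b \<circ> k)"
    using comm unfolding g conjm_comp[OF assms(1)] .
  then have "k \<circ> rot a = rot b \<circ> k" using conjm_eq_iff[OF assms(1)] by blast
  then have "k (rot a z) = rot b (k z)" for z by (metis comp_apply)
  then have "k (Some 0) \<in> {Some 0, None}" "k None \<in> {Some 0, None}"
    using rot_fixed[OF assms(3,4)] rot_fixed[OF assms(5,6)] by (metis insertCI)+
  from moebius_swap_or_fix[OF k this] show ?thesis unfolding axial_map_def g by blast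
qed

lemma flip_conjugate_rot:
  assumes "c \<noteq> 0"
  obtains \<psi> where "moebius \<psi>" "flip c = conjm \<psi> (rot (-1))"
proof -
  define r where "r = csqrt c"
  have r: "r * r = c" "r \<noteq> 0"
    using assms power2_csqrt[of c] unfolding r_def by (auto simp: power2_eq_square)
  \<comment> \<open>This map sends the fixed points \<open>r\<close> and \<open>-r\<close> of
    \<open>flip c\<close> to 0 and infinity.\<close>
  define \<psi> where "\<psi> = mob 1 (-r) 1 r"
  have det: "1 * r - (-r) * 1 \<noteq> 0" using r(2) by simp
  then have \<psi>: "moebius \<psi>" unfolding moebius_iff \<psi>_def by blast
  have "\<psi> (flip c z) = rot (-1) (\<psi> z)" for z
  proof -
    obtain x y where z: "z = proj x y" and nz: "x \<noteq> 0 \<or> y \<noteq> 0" by (rule proj_cases)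
    have "c * y \<noteq> 0 \<or> x \<noteq> 0" using nz assms by auto
    then have "\<psi> (flip c z) = proj (c * y - r * x) (c * y + r * x)"
      using mob_proj[OF det \<open>c * y \<noteq> 0 \<or> x \<noteq> 0\<close>] by (simp add: z \<psi>_def flip_proj[OF assms nz])
    also have "\<dots> = proj (r * (- (x - r * y))) (r * (x + r * y))"
      by (simp add: algebra_simps flip: r(1))
    also have "\<dots> = proj (- (x - r * y)) (x + r * y)" using r(2) by (rule proj_scale)
    also have "\<dots> = rot (-1) (\<psi> z)"
      using mob_proj[OF det nz] mob_nonzero[OF det nz] rot_proj[of "-1" "x - r * y" "x + r * y"]
      by (simp add: z \<psi>_def)
    finally show ?thesis .
  qed
  then have "flip c = conjm \<psi> (rot (-1))"
    using \<psi> unfolding conjm_def fun_eq_iff comp_apply by (metis moebius_inv_apply(1))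
  with \<psi> show ?thesis by (rule that)
qed

text \<open>A rotation of order 2 has factor -1 already; a flip becomes such a rotation about the
  axis through its own fixed points.\<close>

lemma axial_involution:
  assumes "moebius \<phi>" "axial_map \<phi> s" "s \<circ> s = id" "s \<noteq> id"
  obtains \<psi> where "moebius \<psi>" "s = conjm \<psi> (rot (-1))"
proof -
  obtain c where c: "c \<noteq> 0" "s = conjm \<phi> (rot c) \<or> s = conjm \<phi> (flip c)"
    using assms(2) by (auto simp: axial_map_def)
  from c(2) show ?thesis
  proof
    assume s: "s = conjm \<phi> (rot c)"
    have "rot (c * c) = rot 1"
      using assms(3) c(1) unfolding s conjm_comp[OF assms(1)] conjm_eq_id_iff[OF assms(1)]
      by (simp add: rot_flip_comp)
    then have "c * c = 1" using c(1) by (subst (asm) rot_eq_iff) auto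
    moreover have "c \<noteq> 1" using assms(1,4) s conjm_id by auto
    ultimately have "c = -1" by (simp add: square_eq_1_iff)
    then show ?thesis using that[of \<phi>] assms(1) s by simp
  next
    assume s: "s = conjm \<phi> (flip c)"
    obtain \<psi> where \<psi>: "moebius \<psi>" "flip c = conjm \<psi> (rot (-1))"
      using flip_conjugate_rot[OF c(1)] .
    show ?thesis
      using that[of "\<psi> \<circ> \<phi>"] moebius_comp[OF \<psi>(1) assms(1)]
        conjm_conjm[OF assms(1) \<psi>(1)] s \<psi>(2) by simp
  qed
qed

text \<open>Pointwise the two maps differ by a root of unity; one root occurs infinitely often, and
  rational maps that agree infinitely often are equal.\<close>

lemma pw_comp_eq:
  assumes "d > 0" "ratl g" "ratl h" "pw d \<circ> g = pw d \<circ> h"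
  obtains \<omega> where "\<omega> ^ d = 1" "g = rot \<omega> \<circ> h"
proof -
  define U where "U = {\<omega> :: complex. \<omega> ^ d = 1}"
  have fin: "finite U" unfolding U_def using assms(1) by (intro finite_roots_unity) simp
  have U0: "\<omega> \<noteq> 0" if "\<omega> \<in> U" for \<omega> using that assms(1) by (auto simp: U_def zero_power)
  have *: "\<exists>\<omega>\<in>U. x = rot \<omega> y" if eq: "pw d x = pw d y" for x y
  proof (cases x)
    case None
    then have "y = None" using eq by (auto simp: pw_def)
    with None show ?thesis by (intro bexI[of _ 1]) (auto simp: U_def)
  next
    case (Some a)
    then obtain b where y: "y = Some b" and ab: "a ^ d = b ^ d"
      using eq by (cases y) (auto simp: pw_def)
    show ?thesis
    proof (cases "b = 0")
      case True
      then have "a = 0" using ab assms(1) by (simp add: zero_power)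
      with True Some y show ?thesis by (intro bexI[of _ 1]) (auto simp: U_def)
    next
      case False
      then have "a \<noteq> 0" using ab assms(1) by (auto simp: zero_power)
      then show ?thesis using Some y ab False
        by (intro bexI[of _ "a / b"]) (auto simp: U_def rot_Some power_divide)
    qed
  qed
  have "UNIV = (\<Union>\<omega>\<in>U. {w. g (Some w) = (rot \<omega> \<circ> h) (Some w)})"
  proof (intro equalityI subsetI)
    fix w
    have "pw d (g (Some w)) = pw d (h (Some w))" using assms(4) by (metis comp_apply)
    from *[OF this] show "w \<in> (\<Union>\<omega>\<in>U. {w. g (Some w) = (rot \<omega> \<circ> h) (Some w)})" by auto
  qed simp
  then have "\<exists>\<omega>\<in>U. infinite {w. g (Some w) = (rot \<omega> \<circ> h) (Some w)}"
    using fin infinite_UNIV_char_0[where 'a = complex] by (metis (no_types, lifting) finite_UN_I)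
  then obtain \<omega> where \<omega>: "\<omega> \<in> U" "infinite {w. g (Some w) = (rot \<omega> \<circ> h) (Some w)}" by blast
  have "g = rot \<omega> \<circ> h"
    using ratl_eqI[OF assms(2) ratl_moebius_comp[OF moebius_rot[OF U0] assms(3)]] \<omega> by blast
  with \<omega>(1) show ?thesis using that by (simp add: U_def)
qed

section \<open>Deck groups of the iterates of a map in normal form\<close>

locale bicritical_form =
  fixes f A B :: "sphere \<Rightarrow> sphere" and d :: nat
  assumes A: "moebius A" and B: "moebius B" and d: "d \<ge> 2" and f: "f = A \<circ> pw d \<circ> B"
begin

text \<open>For \<open>d\<close>-th roots of unity \<omega> these are the deck transformations of
  \<open>f\<close> itself.\<close>

definition R :: "complex \<Rightarrow> sphere \<Rightarrow> sphere" where "R \<omega> = conjm B (rot \<omega>)"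

lemma root_nonzero: "(\<omega> :: complex) ^ d = 1 \<Longrightarrow> \<omega> \<noteq> 0"
  using d by (cases d) auto

lemma R_comp: "a \<noteq> 0 \<Longrightarrow> b \<noteq> 0 \<Longrightarrow> R a \<circ> R b = R (a * b)"
  unfolding R_def conjm_comp[OF B] by (simp add: rot_flip_comp)

lemma R_1: "R 1 = id"
  by (simp add: R_def conjm_id[OF B])

lemma f_R:
  assumes "\<omega> ^ d = 1"
  shows "f \<circ> R \<omega> = f"
proof -
  have "pw d (rot \<omega> z) = pw d z" for z
    using root_nonzero[OF assms] assms
    by (cases z) (auto simp: pw_def rot_Some rot_None power_mult_distrib)
  then show ?thesis by (simp add: f R_def conjm_def fun_eq_iff B)
qed

text \<open>With the inner map \<open>g\<close> carried along, the induction only post-composes. The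
  cases needed are a deck transformation and \<open>id\<close>.\<close>

lemma ratl_iterate: "ratl g \<Longrightarrow> ratl (f ^^ k \<circ> g)"
proof (induction k)
  case (Suc k)
  have eq: "f ^^ Suc k \<circ> g = A \<circ> (pw d \<circ> (B \<circ> (f ^^ k \<circ> g)))" by (simp add: f comp_assoc)
  have "d > 0" using d by simp
  from ratl_moebius_comp[OF A ratl_pw_comp[OF this ratl_moebius_comp[OF B Suc.IH[OF Suc.prems]]]]
  show ?case unfolding eq .
qed simp

text \<open>Cancelling \<open>A\<close> in the equation for the next iterate leaves two rational
  maps with the same \<open>d\<close>-th power. When \<omega> is 1, \<tau> already lies in the deck
  group of \<open>f ^^ k\<close>.\<close>

lemma Deck_Suc:
  assumes "\<tau> \<in> Deck (f ^^ Suc k)"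
  obtains \<omega> where "\<omega> ^ d = 1" "f ^^ k \<circ> \<tau> = R \<omega> \<circ> f ^^ k"
proof -
  have "A (pw d (B ((f ^^ k) (\<tau> z)))) = A (pw d (B ((f ^^ k) z)))" for z
    using DeckD(2)[OF assms, of z] by (simp add: f)
  then have "pw d (B ((f ^^ k) (\<tau> z))) = pw d (B ((f ^^ k) z))" for z
    by (metis moebius_inv_apply(1)[OF A])
  then have eq: "pw d \<circ> (B \<circ> (f ^^ k \<circ> \<tau>)) = pw d \<circ> (B \<circ> (f ^^ k \<circ> id))"
    by (simp add: fun_eq_iff)
  obtain \<omega> where \<omega>: "\<omega> ^ d = 1" "B \<circ> (f ^^ k \<circ> \<tau>) = rot \<omega> \<circ> (B \<circ> (f ^^ k \<circ> id))"
    using pw_comp_eq[OF _ ratl_moebius_comp[OF B ratl_iterate] ratl_moebius_comp[OF B ratl_iterate] eq]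
      d ratl_moebius[OF DeckD(1)[OF assms]] ratl_id by auto
  then have "inv_into UNIV B (B ((f ^^ k) (\<tau> z))) = inv_into UNIV B (rot \<omega> (B ((f ^^ k) z)))" for z
    by (metis comp_apply id_apply)
  then have "f ^^ k \<circ> \<tau> = R \<omega> \<circ> f ^^ k"
    by (simp add: R_def conjm_def fun_eq_iff B)
  with \<omega>(1) show ?thesis by (rule that)
qed

lemma R_in_Deck:
  assumes "\<omega> ^ d = 1"
  shows "R \<omega> \<in> Deck (f ^^ Suc k)"
proof -
  have "f ^^ Suc k \<circ> R \<omega> = f ^^ k \<circ> (f \<circ> R \<omega>)" by (simp add: funpow_Suc_right comp_assoc del: funpow.simps)
  then show ?thesis
    using f_R[OF assms] moebius_conjm[OF B moebius_rot[OF root_nonzero[OF assms]]]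
    by (simp add: Deck_def R_def funpow_Suc_right del: funpow.simps)
qed

text \<open>By \<open>Deck_Suc\<close>, \<open>g\<close> carries fibres of \<open>f ^^ k\<close>
  into fibres, and \<open>h\<close> preserves each fibre.\<close>

lemma Deck_conj:
  assumes g: "g \<in> Deck (f ^^ Suc k)" and h: "h \<in> Deck (f ^^ k)"
  shows "g \<circ> h \<circ> inv_into UNIV g \<in> Deck (f ^^ k)"
proof -
  obtain \<omega> where "f ^^ k \<circ> g = R \<omega> \<circ> f ^^ k" using Deck_Suc[OF g] .
  then have "(f ^^ k) (g z) = R \<omega> ((f ^^ k) z)" for z by (metis comp_apply)
  then have "(f ^^ k) (g (h z)) = (f ^^ k) (g z)" for z using DeckD(2)[OF h] by metis
  moreover note g' = DeckD(1)[OF g]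
  ultimately show ?thesis
    using DeckD(1)[OF h] by (auto simp: Deck_def fun_eq_iff intro!: moebius_comp moebius_inv)
qed

text \<open>Powers of \<open>g\<close> act after \<open>f ^^ k\<close> as powers of the same root of
  unity, which has order dividing \<open>d\<close>.\<close>

lemma Deck_power:
  assumes "g \<in> Deck (f ^^ Suc k)"
  shows "g ^^ d \<in> Deck (f ^^ k)"
proof -
  obtain \<omega> where \<omega>: "\<omega> ^ d = 1" "f ^^ k \<circ> g = R \<omega> \<circ> f ^^ k" using Deck_Suc[OF assms] .
  note \<omega>0 = root_nonzero[OF \<omega>(1)]
  have "f ^^ k \<circ> g ^^ n = R (\<omega> ^ n) \<circ> f ^^ k" for n
  proof (induction n)
    case 0
    then show ?case by (simp add: R_1)
  next
    case (Suc n)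
    have "f ^^ k \<circ> g ^^ Suc n = (f ^^ k \<circ> g) \<circ> g ^^ n" by (simp add: comp_assoc)
    also have "\<dots> = R \<omega> \<circ> (f ^^ k \<circ> g ^^ n)" by (simp only: \<omega>(2) comp_assoc)
    also have "\<dots> = (R \<omega> \<circ> R (\<omega> ^ n)) \<circ> f ^^ k" by (simp only: Suc comp_assoc)
    also have "R \<omega> \<circ> R (\<omega> ^ n) = R (\<omega> ^ Suc n)" using \<omega>0 by (simp add: R_comp)
    finally show ?case .
  qed
  then have "f ^^ k \<circ> g ^^ d = f ^^ k" using \<omega>(1) by (simp add: R_1)
  moreover have "moebius (g ^^ n)" for n
    by (induction n) (simp_all only: funpow.simps moebius_id moebius_comp DeckD(1)[OF assms])
  ultimately show ?thesis by (simp add: Deck_def)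
qed

lemma Deck_exponent: "g \<in> Deck (f ^^ k) \<Longrightarrow> g ^^ (d ^ k) = id"
proof (induction k arbitrary: g)
  case 0
  then show ?case by (simp add: Deck_def fun_eq_iff)
next
  case (Suc k)
  from Suc.IH[OF Deck_power[OF Suc.prems]] show ?case by (simp add: funpow_mult)
qed

text \<open>For \<open>d = 2\<close> the only root of unity besides 1 is -1, so \<open>g\<close> and
  \<open>h\<close> have the same composite with \<open>f ^^ k\<close>.\<close>

lemma Deck_index_two:
  assumes "d = 2" and "g \<in> Deck (f ^^ Suc k)" "g \<notin> Deck (f ^^ k)"
    and "h \<in> Deck (f ^^ Suc k)" "h \<notin> Deck (f ^^ k)"
  shows "g \<circ> inv_into UNIV h \<in> Deck (f ^^ k)"
proof -
  have *: "f ^^ k \<circ> g = R (-1) \<circ> f ^^ k" if g: "g \<in> Deck (f ^^ Suc k)" "g \<notin> Deck (f ^^ k)" for g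
  proof -
    obtain \<omega> where \<omega>: "\<omega> ^ d = 1" "f ^^ k \<circ> g = R \<omega> \<circ> f ^^ k" using Deck_Suc[OF g(1)] .
    have "\<omega> \<noteq> 1" using \<omega>(2) g DeckD(1)[OF g(1)] by (auto simp: R_1 Deck_def)
    with \<omega> assms(1) show ?thesis by (auto simp: power2_eq_1_iff)
  qed
  have "(f ^^ k) (g z) = (f ^^ k) (h z)" for z
    using *[OF assms(2,3)] *[OF assms(4,5)] by (metis comp_apply)
  then have "(f ^^ k) (g (inv_into UNIV h z)) = (f ^^ k) z" for z
    using DeckD(1)[OF assms(4)] by simp
  then show ?thesis
    using DeckD(1)[OF assms(4)] DeckD(1)[OF assms(2)]
    by (simp add: Deck_def fun_eq_iff moebius_comp moebius_inv)
qed

text \<open>Exponent 2 makes \<open>H\<close> abelian, and \<open>H\<close> has index two. An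
  element of \<open>H\<close> is therefore central as soon as it commutes with \<tau>.\<close>

lemma central_involution:
  assumes d2: "d = 2" and exp2: "\<And>h. h \<in> Deck (f ^^ Suc k) \<Longrightarrow> h \<circ> h = id"
    and \<tau>: "\<tau> \<in> Deck (f ^^ Suc (Suc k))" "\<tau> \<notin> Deck (f ^^ Suc k)"
  obtains s where "s \<in> Deck (f ^^ Suc k)" "s \<noteq> id"
    "\<And>g. g \<in> Deck (f ^^ Suc (Suc k)) \<Longrightarrow> g \<circ> s = s \<circ> g"
proof -
  define H where "H = Deck (f ^^ Suc k)"
  note mb = DeckD(1)[OF \<tau>(1)]
  have comm: "g \<circ> h = h \<circ> g" if "g \<in> H" "h \<in> H" for g h
  proof -
    have "(g \<circ> h) \<circ> (g \<circ> h) = id" "g \<circ> g = id" "h \<circ> h = id"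
      using that exp2 Deck_comp unfolding H_def by blast+
    then have "g (h (g (h z))) = z" "g (g z) = z" "h (h z) = z" for z
      by (metis comp_apply id_apply)+
    then have "g (h z) = h (g z)" for z by metis
    then show ?thesis by (simp add: fun_eq_iff)
  qed
  define t where "t = R (-1)"
  define t' where "t' = \<tau> \<circ> t \<circ> inv_into UNIV \<tau>"
  have t: "t \<in> H" unfolding H_def t_def using d2 by (intro R_in_Deck) simp
  have t': "t' \<in> H" unfolding H_def t'_def using Deck_conj[OF \<tau>(1)] t H_def by blast
  have "t \<noteq> id"
    unfolding t_def R_def using conjm_eq_id_iff[OF B] rot_eq_iff[of "-1" 1] by simp
  have "\<tau> \<circ> \<tau> \<in> H"
    using Deck_power[OF \<tau>(1)] d2 unfolding H_def by (simp add: numeral_2_eq_2)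
  have 1: "\<tau> \<circ> t = t' \<circ> \<tau>" by (simp add: t'_def fun_eq_iff mb)
  \<comment> \<open>Since \<open>\<tau> \<circ> \<tau>\<close> lies in the abelian group
    \<open>H\<close>, it commutes with \<open>t\<close>; conjugation by \<tau> thus swaps
    \<open>t\<close> and \<open>t'\<close>.\<close>
  have 2: "\<tau> \<circ> t' = t \<circ> \<tau>"
  proof -
    have "\<tau> (\<tau> (t z)) = t (\<tau> (\<tau> z))" for z
      using comm[OF \<open>\<tau> \<circ> \<tau> \<in> H\<close> t] by (metis comp_apply)
    then show ?thesis by (simp add: t'_def fun_eq_iff mb)
  qed
  \<comment> \<open>Either \<open>t\<close> is fixed under conjugation by \<tau>, or the product of
    the swapped commuting pair is. The product is not \<open>id\<close>, since \<open>t\<close> is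
    its own inverse and differs from \<open>t'\<close>.\<close>
  define s where "s = (if t' = t then t else t \<circ> t')"
  have "s \<in> H" using t t' Deck_comp H_def s_def by auto
  moreover have "s \<noteq> id"
  proof (cases "t' = t")
    case True
    then show ?thesis using \<open>t \<noteq> id\<close> s_def by simp
  next
    case False
    have "t \<circ> t = id" using exp2 t H_def by blast
    then have "t' = t" if "t \<circ> t' = id"
      using that by (metis comp_assoc comp_id id_comp)
    with False show ?thesis by (auto simp: s_def)
  qed
  moreover have \<tau>s: "\<tau> \<circ> s = s \<circ> \<tau>"
  proof (cases "t' = t")
    case True
    then show ?thesis using 1 s_def by simp
  next
    case False
    have "\<tau> \<circ> (t \<circ> t') = t' \<circ> (\<tau> \<circ> t')" using 1 by (metis comp_assoc)
    also have "\<dots> = (t \<circ> t') \<circ> \<tau>" using 2 comm[OF t t'] by (metis comp_assoc)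
    finally show ?thesis using False s_def by simp
  qed
  moreover have "g \<circ> s = s \<circ> g" if g: "g \<in> Deck (f ^^ Suc (Suc k))" for g
  proof (cases "g \<in> H")
    case True
    then show ?thesis using comm \<open>s \<in> H\<close> by blast
  next
    case False
    define h where "h = g \<circ> inv_into UNIV \<tau>"
    have "h \<in> H" using Deck_index_two[OF d2 g _ \<tau>] False unfolding H_def h_def by blast
    then have "h \<circ> s = s \<circ> h" using comm \<open>s \<in> H\<close> by blast
    moreover have "g = h \<circ> \<tau>" by (simp add: h_def fun_eq_iff mb)
    ultimately show ?thesis using \<tau>s by (metis comp_assoc)
  qed
  ultimately show ?thesis using that H_def by blast
qed

text \<open>The axis is quantified existentially because the next iterate may need a different one.
  At the first iterate all deck transformations are rotations about the axis of
  \<open>B\<close>.\<close>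

lemma Deck_axial: "\<exists>\<phi>. moebius \<phi> \<and> (\<forall>g\<in>Deck (f ^^ Suc k). axial_map \<phi> g)"
proof (induction k)
  case 0
  have "axial_map B g" if g: "g \<in> Deck (f ^^ Suc 0)" for g
  proof -
    obtain \<omega> where "\<omega> ^ d = 1" "f ^^ 0 \<circ> g = R \<omega> \<circ> f ^^ 0" using Deck_Suc[OF g] .
    then show ?thesis using root_nonzero by (auto simp: axial_map_def R_def)
  qed
  then show ?case using B by blast
next
  case (Suc k)
  then obtain \<phi> where \<phi>: "moebius \<phi>" and ax: "\<And>g. g \<in> Deck (f ^^ Suc k) \<Longrightarrow> axial_map \<phi> g" by blast
  show ?case
  \<comment> \<open>The condition \<open>c * c \<noteq> 1\<close> says that the rotation is neither
    \<open>id\<close> nor an involution.\<close>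
  proof (cases "\<exists>c. c \<noteq> 0 \<and> c * c \<noteq> 1 \<and> conjm \<phi> (rot c) \<in> Deck (f ^^ Suc k)")
    case True
    then obtain c where c: "c \<noteq> 0" "c * c \<noteq> 1" "conjm \<phi> (rot c) \<in> Deck (f ^^ Suc k)" by blast
    define x where "x = conjm \<phi> (rot c)"
    have xx: "x \<circ> x \<noteq> id"
    proof
      assume "x \<circ> x = id"
      then have "rot (c * c) = rot 1"
        unfolding x_def conjm_comp[OF \<phi>] conjm_eq_id_iff[OF \<phi>] using c(1) by (simp add: rot_flip_comp)
      then show False using c by (subst (asm) rot_eq_iff) auto
    qed
    have "axial_map \<phi> g" if g: "g \<in> Deck (f ^^ Suc (Suc k))" for g
    proof -
      note mg = DeckD(1)[OF g]
      define y where "y = g \<circ> x \<circ> inv_into UNIV g"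
      have gx: "g \<circ> x = y \<circ> g" by (simp add: y_def fun_eq_iff mg)
      have yy: "y \<circ> y \<noteq> id"
      proof
        assume "y \<circ> y = id"
        then have "g (x (x (inv_into UNIV g z))) = z" for z
          using mg by (simp add: y_def fun_eq_iff)
        then have "x (x z) = z" for z by (metis moebius_inv_apply(1)[OF mg])
        then show False using xx by (auto simp: fun_eq_iff)
      qed
      have "y \<in> Deck (f ^^ Suc k)" unfolding y_def x_def by (rule Deck_conj[OF g c(3)])
      then obtain b where b: "b \<noteq> 0" "y = conjm \<phi> (rot b) \<or> y = conjm \<phi> (flip b)"
        using ax axial_map_def by blast
      \<comment> \<open>Flips square to \<open>id\<close>, and \<open>y\<close> does not. So
        \<open>g\<close> conjugates one nontrivial rotation about the axis into another and must
        preserve the axis.\<close>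
      have "y \<noteq> conjm \<phi> (flip b)"
        using yy b(1) conjm_id[OF \<phi>] by (auto simp: conjm_comp[OF \<phi>] rot_flip_comp)
      with b have y: "y = conjm \<phi> (rot b)" by blast
      have "b \<noteq> 1" using yy y conjm_id[OF \<phi>] by auto
      moreover have "c \<noteq> 1" using c(2) by auto
      ultimately show ?thesis
        using axial_of_conjugation[OF \<phi> mg c(1) _ b(1)] gx unfolding y x_def by blast
    qed
    then show ?thesis using \<phi> by blast
  next
    case False
    have exp2: "h \<circ> h = id" if h: "h \<in> Deck (f ^^ Suc k)" for h
    proof -
      obtain x b where b: "b \<noteq> 0" "x = rot b \<or> x = flip b" and hx: "h = conjm \<phi> x"
        using ax[OF h] axial_map_def by blast
      have "x \<circ> x = id"
        using b(2)
      proof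
        assume x: "x = rot b"
        have "b * b = 1" using False b(1) h unfolding hx x by blast
        then show ?thesis using b(1) by (simp add: x rot_flip_comp)
      next
        assume x: "x = flip b"
        then show ?thesis using b(1) by (simp add: rot_flip_comp)
      qed
      then show ?thesis by (simp only: hx conjm_comp[OF \<phi>] conjm_id[OF \<phi>])
    qed
    \<comment> \<open>The deck transformations of \<open>f\<close> belong to this group of exponent
      2, so every \<open>d\<close>-th root of unity squares to 1; counting roots gives
      \<open>d = 2\<close>.\<close>
    have "{\<omega> :: complex. \<omega> ^ d = 1} \<subseteq> {\<omega>. \<omega> ^ 2 = 1}"
    proof clarify
      fix \<omega> :: complex assume \<omega>: "\<omega> ^ d = 1"
      have "R (\<omega> * \<omega>) = id"
        using exp2[OF R_in_Deck[OF \<omega>]] root_nonzero[OF \<omega>] by (simp add: R_comp)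
      then have "rot (\<omega> * \<omega>) = rot 1" unfolding R_def conjm_eq_id_iff[OF B] by simp
      then show "\<omega> ^ 2 = 1"
        using root_nonzero[OF \<omega>] by (subst (asm) rot_eq_iff) (auto simp: power2_eq_square)
    qed
    then have "card {\<omega> :: complex. \<omega> ^ d = 1} \<le> card {\<omega> :: complex. \<omega> ^ 2 = 1}"
      by (intro card_mono finite_roots_unity) auto
    then have d2: "d = 2" using d by (simp add: card_roots_unity_eq)
    show ?thesis
    proof (cases "Deck (f ^^ Suc (Suc k)) \<subseteq> Deck (f ^^ Suc k)")
      case True
      then show ?thesis using \<phi> ax by blast
    next
      case False
      then obtain \<tau> where \<tau>: "\<tau> \<in> Deck (f ^^ Suc (Suc k))" "\<tau> \<notin> Deck (f ^^ Suc k)" by blast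
      obtain s where s: "s \<in> Deck (f ^^ Suc k)" "s \<noteq> id"
        "\<And>g. g \<in> Deck (f ^^ Suc (Suc k)) \<Longrightarrow> g \<circ> s = s \<circ> g"
        using central_involution[OF d2 exp2 \<tau>] by blast
      obtain \<psi> where \<psi>: "moebius \<psi>" "s = conjm \<psi> (rot (-1))"
        using axial_involution[OF \<phi> ax[OF s(1)] exp2[OF s(1)] s(2)] .
      \<comment> \<open>A map commuting with \<open>s\<close> permutes the fixed points of
        \<open>s\<close>, which form the new axis.\<close>
      have "axial_map \<psi> g" if g: "g \<in> Deck (f ^^ Suc (Suc k))" for g
        using axial_of_conjugation[OF \<psi>(1) DeckD(1)[OF g], of "-1" "-1"] s(3)[OF g] \<psi>(2) by simp
      then show ?thesis using \<psi>(1) by blast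
    qed
  qed
qed

end

section \<open>Structure of the deck group\<close>

lemma group_deck_group: "group (deck_group F)"
proof (rule groupI)
  fix x assume "x \<in> carrier (deck_group F)"
  then have x: "x \<in> Deck F" by (simp add: deck_group_def)
  show "\<exists>y\<in>carrier (deck_group F). y \<otimes>\<^bsub>deck_group F\<^esub> x = \<one>\<^bsub>deck_group F\<^esub>"
    using Deck_inv[OF x] moebius_inv_comp(1)[OF DeckD(1)[OF x]]
    unfolding deck_group_def monoid.simps partial_object.simps by blast
qed (auto simp: deck_group_def Deck_comp Deck_id comp_assoc)

lemma deck_group_simps:
  "carrier (deck_group F) = Deck F"
  "x \<otimes>\<^bsub>deck_group F\<^esub> y = x \<circ> y"
  "\<one>\<^bsub>deck_group F\<^esub> = id"
  by (simp_all add: deck_group_def)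

text \<open>The generator is the power of a primitive root with the least positive exponent in
  \<open>C\<close>; division with remainder shows that it generates.\<close>

lemma roots_subgroup_cyclic:
  fixes C :: "complex set"
  assumes N: "N > 0" and C: "C \<subseteq> {c. c ^ N = 1}" "1 \<in> C"
    and mult: "\<And>a b. a \<in> C \<Longrightarrow> b \<in> C \<Longrightarrow> a * b \<in> C"
  obtains \<rho> where "\<rho> \<in> C" "C = range (\<lambda>i::nat. \<rho> ^ i)"
proof -
  define \<zeta> where "\<zeta> = exp (2 * of_real pi * \<i> / of_nat N)"
  have pow: "\<zeta> ^ j = exp (2 * of_real pi * \<i> * of_nat j / of_nat N)" for j
    unfolding \<zeta>_def by (subst exp_of_nat_mult[symmetric]) (simp add: field_simps)
  have roots: "{c. c ^ N = 1} = {\<zeta> ^ j | j. j < N}"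
    using N unfolding pow by (subst complex_roots_unity) auto
  have \<zeta>N: "\<zeta> ^ N = 1" using N by (simp add: pow exp_eq_1 del: exp_of_nat_mult)
  have power: "c ^ i \<in> C" if "c \<in> C" for c and i :: nat
    using that C(2) mult by (induction i) auto
  define m where "m = (LEAST m. m > 0 \<and> \<zeta> ^ m \<in> C)"
  have ex: "N > 0 \<and> \<zeta> ^ N \<in> C" using \<zeta>N C(2) N by simp
  have m: "m > 0" "\<zeta> ^ m \<in> C" using LeastI[where P = "\<lambda>m. m > 0 \<and> \<zeta> ^ m \<in> C", OF ex] m_def by auto
  have "\<exists>i::nat. c = (\<zeta> ^ m) ^ i" if c: "c \<in> C" for c
  proof -
    obtain j where j: "c = \<zeta> ^ j" using c C(1) roots by blast
    define q r where "q = j div m" and "r = j mod m"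
    have jqr: "j = m * q + r" by (simp add: q_def r_def)
    define x where "x = (\<zeta> ^ m) ^ q"
    have x: "x \<in> C" unfolding x_def by (rule power[OF m(2)])
    \<comment> \<open>Closure under products suffices, because \<open>x ^ (N - 1)\<close> serves as
      the inverse of \<open>x\<close>.\<close>
    then have "x ^ (N - 1) * x = 1" using C(1) N by (auto simp flip: power_Suc2)
    then have "\<zeta> ^ r = x ^ (N - 1) * c"
      unfolding j jqr by (simp add: power_add power_mult x_def[symmetric] flip: mult.assoc)
    also have "\<dots> \<in> C" by (intro mult power x c)
    finally have "\<zeta> ^ r \<in> C" .
    moreover have "r < m" using m(1) by (simp add: r_def)
    ultimately have "r = 0" using not_less_Least[of r "\<lambda>m. m > 0 \<and> \<zeta> ^ m \<in> C"] m_def by auto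
    then show ?thesis using j jqr by (auto simp: power_mult)
  qed
  then have "C = range (\<lambda>i::nat. (\<zeta> ^ m) ^ i)" using power[OF m(2)] by blast
  then show ?thesis using that m(2) by blast
qed

section \<open>Groups of axial maps of finite exponent\<close>

context
  fixes F \<phi> :: "sphere \<Rightarrow> sphere" and N :: nat
  assumes \<phi>: "moebius \<phi>" and axial: "\<And>g. g \<in> Deck F \<Longrightarrow> axial_map \<phi> g"
    and N: "N > 0" and exponent: "\<And>g. g \<in> Deck F \<Longrightarrow> g ^^ N = id"
begin

interpretation group "deck_group F" by (rule group_deck_group)

lemma conjm_rot_pow: "c \<noteq> 0 \<Longrightarrow> conjm \<phi> (rot c) [^]\<^bsub>deck_group F\<^esub> (i::nat) = conjm \<phi> (rot (c ^ i))"
  by (induction i) (simp_all add: deck_group_simps conjm_id[OF \<phi>] conjm_comp[OF \<phi>] rot_flip_comp mult.commute)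

lemma rotations_cyclic:
  obtains \<rho> where "\<rho> \<noteq> 0" "conjm \<phi> (rot \<rho>) \<in> Deck F"
    "\<And>c. c \<noteq> 0 \<Longrightarrow> conjm \<phi> (rot c) \<in> Deck F \<longleftrightarrow> (\<exists>i::nat. c = \<rho> ^ i)"
proof -
  define C where "C = {c. c \<noteq> 0 \<and> conjm \<phi> (rot c) \<in> Deck F}"
  have "c ^ N = 1" if c: "c \<in> C" for c
  proof -
    have "conjm \<phi> (rot c) ^^ i = conjm \<phi> (rot (c ^ i))" for i
      using c unfolding C_def
      by (induction i) (simp_all only: funpow.simps, simp_all add: conjm_id[OF \<phi>] conjm_comp[OF \<phi>] rot_flip_comp)
    moreover have "conjm \<phi> (rot c) ^^ N = id" using exponent c by (simp add: C_def)
    ultimately have "rot (c ^ N) = rot 1" using conjm_eq_id_iff[OF \<phi>] by simp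
    then show ?thesis using c by (subst (asm) rot_eq_iff) (auto simp: C_def)
  qed
  then have "C \<subseteq> {c. c ^ N = 1}" by blast
  moreover have "1 \<in> C" using Deck_id by (simp add: C_def conjm_id[OF \<phi>])
  moreover have "a * b \<in> C" if "a \<in> C" "b \<in> C" for a b
  proof -
    have "conjm \<phi> (rot a) \<circ> conjm \<phi> (rot b) \<in> Deck F" using that Deck_comp by (auto simp: C_def)
    then show ?thesis using that by (simp add: C_def conjm_comp[OF \<phi>] rot_flip_comp)
  qed
  ultimately obtain \<rho> where \<rho>: "\<rho> \<in> C" "C = range (\<lambda>i::nat. \<rho> ^ i)"
    using roots_subgroup_cyclic[OF N] by metis
  have "conjm \<phi> (rot c) \<in> Deck F \<longleftrightarrow> (\<exists>i::nat. c = \<rho> ^ i)" if "c \<noteq> 0" for c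
  proof -
    have "conjm \<phi> (rot c) \<in> Deck F \<longleftrightarrow> c \<in> C" using that by (simp add: C_def)
    then show ?thesis unfolding \<rho>(2) by blast
  qed
  moreover have "\<rho> \<noteq> 0" "conjm \<phi> (rot \<rho>) \<in> Deck F" using \<rho>(1) by (simp_all add: C_def)
  ultimately show ?thesis using that by blast
qed

lemma cyclic_of_rotations:
  assumes "\<And>c. c \<noteq> 0 \<Longrightarrow> conjm \<phi> (flip c) \<notin> Deck F"
  shows "cyclic_group (deck_group F)"
proof -
  obtain \<rho> where \<rho>: "\<rho> \<noteq> 0" "conjm \<phi> (rot \<rho>) \<in> Deck F"
    "\<And>c. c \<noteq> 0 \<Longrightarrow> conjm \<phi> (rot c) \<in> Deck F \<longleftrightarrow> (\<exists>i::nat. c = \<rho> ^ i)"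
    using rotations_cyclic by blast
  let ?r = "conjm \<phi> (rot \<rho>)"
  have r: "?r \<in> carrier (deck_group F)" using \<rho>(2) by (simp add: deck_group_simps)
  have "carrier (deck_group F) = range (\<lambda>n::int. ?r [^]\<^bsub>deck_group F\<^esub> n)"
  proof (intro equalityI subsetI)
    fix g assume "g \<in> carrier (deck_group F)"
    then have g: "g \<in> Deck F" by (simp add: deck_group_simps)
    then obtain c where c: "c \<noteq> 0" "g = conjm \<phi> (rot c)"
      using axial assms axial_map_def by blast
    then obtain i :: nat where "c = \<rho> ^ i" using g \<rho>(3) by blast
    then have "g = ?r [^]\<^bsub>deck_group F\<^esub> int i"
      using c(2) conjm_rot_pow[OF \<rho>(1)] by (simp add: int_pow_int)
    then show "g \<in> range (\<lambda>n::int. ?r [^]\<^bsub>deck_group F\<^esub> n)" by blast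
  qed (use r in auto)
  then show ?thesis using r cyclic_group by blast
qed

text \<open>A flip is an involution, so its odd power \<open>N\<close> is the flip itself, which is
  not \<open>id\<close>.\<close>

lemma cyclic_of_odd_exponent:
  assumes "odd N"
  shows "cyclic_group (deck_group F)"
proof (rule cyclic_of_rotations)
  fix c :: complex assume c: "c \<noteq> 0"
  show "conjm \<phi> (flip c) \<notin> Deck F"
  proof
    define s where "s = conjm \<phi> (flip c)"
    assume "conjm \<phi> (flip c) \<in> Deck F"
    then have "s ^^ N = id" using exponent s_def by blast
    moreover have "s \<circ> s = id"
      using c unfolding s_def by (simp add: conjm_comp[OF \<phi>] rot_flip_comp conjm_id[OF \<phi>])
    then have "s ^^ 2 = id" by (simp add: numeral_2_eq_2)
    then have "(s ^^ 2) ^^ m = id" for m by simp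
    then have "s ^^ (2 * m) = id" for m by (simp add: funpow_mult)
    moreover obtain m where "N = Suc (2 * m)" using assms by (metis oddE Suc_eq_plus1)
    ultimately have "s = id" by (metis funpow.simps(2) comp_id)
    then have "flip c = rot 1" unfolding s_def conjm_eq_id_iff[OF \<phi>] by simp
    then show False using rot_neq_flip[of 1 c] c by simp
  qed
qed

text \<open>The rotations are the powers of \<open>r\<close>, the chosen flip \<open>s\<close>
  inverts \<open>r\<close>, and composing with \<open>s\<close> turns every other flip into a
  rotation.\<close>

lemma cyclic_or_dihedral: "cyclic_group (deck_group F) \<or> dihedral_group (deck_group F)"
proof (cases "\<exists>a. a \<noteq> 0 \<and> conjm \<phi> (flip a) \<in> Deck F")
  case False
  then show ?thesis using cyclic_of_rotations by blast
next
  case True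
  then obtain a where a: "a \<noteq> 0" "conjm \<phi> (flip a) \<in> Deck F" by blast
  obtain \<rho> where \<rho>: "\<rho> \<noteq> 0" "conjm \<phi> (rot \<rho>) \<in> Deck F"
    "\<And>c. c \<noteq> 0 \<Longrightarrow> conjm \<phi> (rot c) \<in> Deck F \<longleftrightarrow> (\<exists>i::nat. c = \<rho> ^ i)"
    using rotations_cyclic by blast
  define r s where "r = conjm \<phi> (rot \<rho>)" and "s = conjm \<phi> (flip a)"
  note simps = deck_group_simps conjm_comp[OF \<phi>] rot_flip_comp conjm_id[OF \<phi>] conjm_eq_iff[OF \<phi>]
  have r: "r \<in> carrier (deck_group F)" and s: "s \<in> carrier (deck_group F)"
    using \<rho>(2) a(2) by (simp_all add: r_def s_def deck_group_simps)
  have rpow: "r [^]\<^bsub>deck_group F\<^esub> i = conjm \<phi> (rot (\<rho> ^ i))" for i :: nat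
    unfolding r_def by (rule conjm_rot_pow[OF \<rho>(1)])
  define n where "n = ord r"
  have rN: "r [^]\<^bsub>deck_group F\<^esub> N = \<one>\<^bsub>deck_group F\<^esub>"
  proof -
    have "r [^]\<^bsub>deck_group F\<^esub> i = r ^^ i" for i :: nat
      by (induction i) (simp_all add: deck_group_simps funpow_Suc_right del: funpow.simps(2))
    then show ?thesis using exponent r by (simp add: deck_group_simps)
  qed
  then have n0: "n > 0" using pow_eq_id[OF r, of N] N n_def by (auto intro!: Nat.gr0I)
  have red: "r [^]\<^bsub>deck_group F\<^esub> (i mod n) = r [^]\<^bsub>deck_group F\<^esub> i" for i :: nat
  proof -
    have "r [^]\<^bsub>deck_group F\<^esub> (n * (i div n)) = \<one>\<^bsub>deck_group F\<^esub>"
      by (subst pow_eq_id[OF r]) (simp add: n_def)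
    moreover have "r [^]\<^bsub>deck_group F\<^esub> (n * (i div n) + i mod n) =
        r [^]\<^bsub>deck_group F\<^esub> (n * (i div n)) \<otimes>\<^bsub>deck_group F\<^esub> r [^]\<^bsub>deck_group F\<^esub> (i mod n)"
      by (rule nat_pow_mult[OF r, symmetric])
    ultimately show ?thesis using r by simp
  qed
  have sne: "s \<noteq> conjm \<phi> (rot c)" if "c \<noteq> 0" for c
    using rot_neq_flip[OF that a(1)] unfolding s_def by (metis conjm_eq_iff[OF \<phi>])
  have ss: "s \<otimes>\<^bsub>deck_group F\<^esub> s = \<one>\<^bsub>deck_group F\<^esub>"
    using a(1) by (simp add: s_def simps)
  have s1: "s \<noteq> \<one>\<^bsub>deck_group F\<^esub>"
    using sne[of 1] by (simp add: simps)
  have srs: "s \<otimes>\<^bsub>deck_group F\<^esub> r \<otimes>\<^bsub>deck_group F\<^esub> s = inv\<^bsub>deck_group F\<^esub> r"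
  proof (rule inv_equality[symmetric])
    show "s \<otimes>\<^bsub>deck_group F\<^esub> r \<otimes>\<^bsub>deck_group F\<^esub> s \<otimes>\<^bsub>deck_group F\<^esub> r = \<one>\<^bsub>deck_group F\<^esub>"
    proof -
      have "s \<circ> r = conjm \<phi> (flip (a / \<rho>))" using a(1) \<rho>(1) by (simp add: s_def r_def simps(4-))
      moreover have "conjm \<phi> (flip (a / \<rho>)) \<circ> s = conjm \<phi> (rot (1 / \<rho>))"
        using a(1) \<rho>(1) unfolding s_def conjm_comp[OF \<phi>] by (subst rot_flip_comp) auto
      moreover have "conjm \<phi> (rot (1 / \<rho>)) \<circ> r = id"
        using \<rho>(1) unfolding r_def conjm_comp[OF \<phi>]
        by (subst rot_flip_comp) (auto simp: conjm_id[OF \<phi>])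
      ultimately show ?thesis unfolding deck_group_simps by simp
    qed
  qed (use r s in auto)
  have decomp: "\<exists>i<n. \<exists>j<2::nat. g = r [^]\<^bsub>deck_group F\<^esub> i \<otimes>\<^bsub>deck_group F\<^esub> s [^]\<^bsub>deck_group F\<^esub> j"
    if g: "g \<in> Deck F" for g
  proof -
    have rot: "\<exists>i<n. h = r [^]\<^bsub>deck_group F\<^esub> i" if h: "h \<in> Deck F" "h = conjm \<phi> (rot c)" "c \<noteq> 0" for h c
    proof -
      obtain i :: nat where "c = \<rho> ^ i" using \<rho>(3)[OF h(3)] h(1) unfolding h(2) by blast
      then have "h = r [^]\<^bsub>deck_group F\<^esub> (i mod n)" unfolding h(2) red by (simp add: rpow)
      then show ?thesis using n0 by (intro exI[of _ "i mod n"]) simp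
    qed
    obtain c where c: "c \<noteq> 0" "g = conjm \<phi> (rot c) \<or> g = conjm \<phi> (flip c)"
      using axial[OF g] axial_map_def by blast
    from c(2) show ?thesis
    proof
      assume "g = conjm \<phi> (rot c)"
      then obtain i where "i < n" "g = r [^]\<^bsub>deck_group F\<^esub> i" using rot g c(1) by blast
      then show ?thesis using r s by (intro exI[of _ i] conjI exI[of _ 0]) auto
    next
      assume gf: "g = conjm \<phi> (flip c)"
      have "g \<circ> s \<in> Deck F" using g s Deck_comp by (simp add: deck_group_simps)
      moreover have "g \<circ> s = conjm \<phi> (rot (c / a))" using gf a(1) c(1) by (simp add: s_def simps)
      ultimately obtain i where i: "i < n" "g \<circ> s = r [^]\<^bsub>deck_group F\<^esub> i"
        using rot[of "g \<circ> s" "c / a"] a(1) c(1) by auto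
      have "g = g \<circ> (s \<circ> s)" using ss by (simp add: deck_group_simps)
      also have "\<dots> = r [^]\<^bsub>deck_group F\<^esub> i \<circ> s" unfolding i(2)[symmetric] by (simp only: comp_assoc)
      finally have "g = r [^]\<^bsub>deck_group F\<^esub> i \<otimes>\<^bsub>deck_group F\<^esub> s [^]\<^bsub>deck_group F\<^esub> (1::nat)"
        using s by (simp add: deck_group_simps(2,3))
      then show ?thesis using i(1) by (intro exI[of _ i] conjI exI[of _ 1]) auto
    qed
  qed
  have car: "carrier (deck_group F) =
    {r [^]\<^bsub>deck_group F\<^esub> i \<otimes>\<^bsub>deck_group F\<^esub> s [^]\<^bsub>deck_group F\<^esub> j | i j :: nat. i < n \<and> j < 2}"
    (is "_ = ?M")
  proof
    show "carrier (deck_group F) \<subseteq> ?M" using decomp unfolding deck_group_simps(1) by blast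
    show "?M \<subseteq> carrier (deck_group F)" using r s by auto
  qed
  show ?thesis
  proof (cases "n = 1")
    case True
    \<comment> \<open>Without nontrivial rotations the group is generated by \<open>s\<close>; being
      of order 2, it falls under the cyclic case, since \<open>dihedral_group\<close> asks for
      \<open>n \<ge> 2\<close>.\<close>
    then have "r [^]\<^bsub>deck_group F\<^esub> i = \<one>\<^bsub>deck_group F\<^esub>" if "i < n" for i :: nat using that by simp
    then have "carrier (deck_group F) \<subseteq> range (\<lambda>j::nat. s [^]\<^bsub>deck_group F\<^esub> j)"
      unfolding car using s by auto
    then have "carrier (deck_group F) \<subseteq> range (\<lambda>j::int. s [^]\<^bsub>deck_group F\<^esub> j)"
      by (force simp flip: int_pow_int)
    then have "carrier (deck_group F) = range (\<lambda>j::int. s [^]\<^bsub>deck_group F\<^esub> j)"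
      using s by auto
    then show ?thesis using s cyclic_group by blast
  next
    case False
    then have n2: "n \<ge> 2" using n0 by simp
    define e where "e = (\<lambda>(i, j::nat). r [^]\<^bsub>deck_group F\<^esub> (i::nat) \<otimes>\<^bsub>deck_group F\<^esub> s [^]\<^bsub>deck_group F\<^esub> j)"
    have "carrier (deck_group F) = e ` ({..<n} \<times> {..<2})"
      unfolding car e_def by force
    moreover have "inj_on e ({..<n} \<times> {..<2})"
    proof (rule inj_onI, clarify)
      fix i j i' j' :: nat
      assume b: "i < n" "j < 2" "i' < n" "j' < 2" and eq: "e (i, j) = e (i', j')"
      \<comment> \<open>The exponent of \<open>s\<close> is determined because no rotation is a
        flip.\<close>
      have ne: "e (k, 0) \<noteq> e (l, 1)" for k l
      proof
        assume "e (k, 0) = e (l, 1)"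
        then have "rot (\<rho> ^ k) = rot (\<rho> ^ l) \<circ> flip a"
          using s by (simp add: e_def rpow s_def simps del: nat_pow_Suc)
        then show False using \<rho>(1) a(1) rot_neq_flip[of "\<rho> ^ k" "\<rho> ^ l * a"] by (simp add: rot_flip_comp)
      qed
      have "j = 0 \<or> j = 1" "j' = 0 \<or> j' = 1" using b by auto
      then have "j = j'" using eq ne by metis
      then have "r [^]\<^bsub>deck_group F\<^esub> i = r [^]\<^bsub>deck_group F\<^esub> i'"
        using eq r s by (simp add: e_def)
      then have "i = i'"
        using b inj_onD[OF ord_inj[OF r], of i i'] n_def by auto
      with \<open>j = j'\<close> show "i = i' \<and> j = j'" by simp
    qed
    ultimately have "card (carrier (deck_group F)) = 2 * n"
      by (simp add: card_image card_cartesian_product)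
    then have "dihedral_group (deck_group F)"
      unfolding dihedral_group_def using n2 r s n_def s1 ss srs car is_group by blast
    then show ?thesis ..
  qed
qed

end

theorem theorem3:
  fixes f :: "sphere \<Rightarrow> sphere" and d k :: nat
  assumes "bicritical f" and "is_rational_map f d"
  shows "(cyclic_group (deck_group (f ^^ k)) \<or> dihedral_group (deck_group (f ^^ k)))
         \<and> (odd d \<longrightarrow> cyclic_group (deck_group (f ^^ k)))"
proof -
  obtain A B where d: "d \<ge> 2" and AB: "moebius A" "moebius B" "f = A \<circ> pw d \<circ> B"
    using bicritical_normal_form[OF assms] by blast
  interpret bicritical_form f A B d by unfold_locales fact+
  have "\<exists>\<phi>. moebius \<phi> \<and> (\<forall>g\<in>Deck (f ^^ k). axial_map \<phi> g)"
  proof (cases k)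
    case 0
    \<comment> \<open>The zeroth iterate lies outside \<open>Deck_axial\<close>; its trivial deck
      group consists of the rotation with factor 1.\<close>
    have "Deck id = {id}" by (auto simp: Deck_def)
    moreover have "axial_map id id"
      unfolding axial_map_def using conjm_id[OF moebius_id] by (intro exI[of _ 1]) simp
    ultimately show ?thesis using 0 moebius_id by (intro exI[of _ id]) (simp add: id_def)
  next
    case (Suc l)
    then show ?thesis using Deck_axial by blast
  qed
  then obtain \<phi> where \<phi>: "moebius \<phi>" "\<And>g. g \<in> Deck (f ^^ k) \<Longrightarrow> axial_map \<phi> g" by blast
  have "d ^ k > 0" using d by simp
  note * = \<phi> this Deck_exponent
  \<comment> \<open>For odd \<open>d\<close> the exponent \<open>d ^ k\<close> is odd too.\<close>
  show ?thesis
    using cyclic_or_dihedral[OF *] cyclic_of_odd_exponent[OF *] by auto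
qed

end
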